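(* Let $N\in\{2,3\}$, let $B^N$ be the unit ball of $\mathbb{R}^N$, and let $W:(-\infty,1]\to[0,\infty)$ be a $C^2$ non-negative convex function with $W(0)=0$. There exists a function $v\in\mathcal{C}^2_c(B^N\setminus\{0\})\subset H^2_0(B^N)$ such that $F_\varepsilon[\nabla v]<0$ when $\varepsilon>0$ is sufficiently small, where $$F_\varepsilon[V]=\frac12\int_{B^N}L_\varepsilon V\cdot V\,dx=\frac12\int_{B^N}\Big[|\nabla V|^2-\frac{1}{\varepsilon^2}W'(1-f_\varepsilon(|x|)^2)|V|^2\Big]\,dx,\qquad V\in H^1_0(B^N,\mathbb{R}^N).$$
   Context: For $\varepsilon>0$, $f_\varepsilon$ is the unique solution of $$-f_\varepsilon''-\frac{N-1}{r}f_\varepsilon'+\frac{N-1}{r^2}f_\varepsilon=\frac{1}{\varepsilon^2}f_\varepsilon W'(1-f_\varepsilon^2)\ \text{ in }(0,1),\qquad f_\varepsilon(0)=0,\ f_\varepsilon(1)=1$$ (known to exist and be unique). The operator $L_\varepsilon=-\Delta-\frac{1}{\varepsilon^2}W'(1-f_\varepsilon^2)$ acts componentwise, with $f_\varepsilon$ evaluated at $r=|x|$. $H^2_0(B^N)$ is the closure of $\mathcal{C}^\infty_c(B^N)$ in $H^2(B^N)$. The function $v$ does not depend on $\varepsilon$.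
   Formalization: The formal statement additionally assumes that W is not identically zero on [0,1]; if W vanishes there (e.g. W = 0), then f_ε(r) = r and F_ε[∇v] = ½∫|D²v|² ≥ 0 for every v, so the claim as printed fails exactly in the excluded cases. *)

theory Defs
  imports "HOL-Analysis.Analysis"
begin

section \<open>Function spaces\<close>

primrec cont_diff :: "nat \<Rightarrow> ('a::euclidean_space \<Rightarrow> real) \<Rightarrow> bool" where
  "cont_diff 0 u \<longleftrightarrow> continuous_on UNIV u"
| "cont_diff (Suc k) u \<longleftrightarrow>
     (\<forall>x. u differentiable (at x)) \<and>
     (\<forall>b\<in>Basis. cont_diff k (\<lambda>x. frechet_derivative u (at x) b))"

text \<open>Functions with compact support in \<open>S\<close> are represented by their extension by zero
  to the whole space.\<close>

definition Cc :: "nat \<Rightarrow> 'a::euclidean_space set \<Rightarrow> ('a \<Rightarrow> real) set" where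
  "Cc k S = {u. cont_diff k u \<and> compact (closure {x. u x \<noteq> 0}) \<and> closure {x. u x \<noteq> 0} \<subseteq> S}"

definition Cc_smooth :: "'a::euclidean_space set \<Rightarrow> ('a \<Rightarrow> real) set" where
  "Cc_smooth S = (\<Inter>k. Cc k S)"

definition grad :: "(real^'n \<Rightarrow> real) \<Rightarrow> real^'n \<Rightarrow> real^'n" where
  "grad u x = (\<chi> i. frechet_derivative u (at x) (axis i 1))"

definition hess :: "(real^'n \<Rightarrow> real) \<Rightarrow> real^'n \<Rightarrow> real^'n^'n" where
  "hess u x = jacobian (grad u) (at x)"

text \<open>The integral is the nonnegative one, so convergence forces finiteness of the distance
  for all large \<open>k\<close>.\<close>

definition L2_converges ::
  "(real^'n) set \<Rightarrow> (nat \<Rightarrow> real^'n \<Rightarrow> 'b::euclidean_space) \<Rightarrow> (real^'n \<Rightarrow> 'b) \<Rightarrow> bool" where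
  "L2_converges S U u \<longleftrightarrow>
     u \<in> borel_measurable (lebesgue_on S) \<and>
     (\<lambda>k. \<integral>\<^sup>+ x. ennreal ((norm (U k x - u x))\<^sup>2) \<partial>lebesgue_on S) \<longlonglongrightarrow> 0"

text \<open>The closure of the test functions in \<open>H\<^sup>2(B)\<close>, \<open>B\<close> the open unit ball.  If test functions
  and their gradients and Hessians converge in \<open>L\<^sup>2(B)\<close> to \<open>u\<close>, \<open>g\<close> and \<open>h\<close>, then \<open>g\<close> and \<open>h\<close>
  are the weak gradient and weak Hessian of \<open>u\<close>, so this is convergence to \<open>u\<close> in \<open>H\<^sup>2(B)\<close>.\<close>

definition H20_ball :: "(real^'n \<Rightarrow> real) set" where
  "H20_ball = {u. \<exists>\<phi> g h.
     (\<forall>k. \<phi> k \<in> Cc_smooth (ball 0 1)) \<and>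
     L2_converges (ball 0 1) \<phi> u \<and>
     L2_converges (ball 0 1) (\<lambda>k. grad (\<phi> k)) g \<and>
     L2_converges (ball 0 1) (\<lambda>k. hess (\<phi> k)) h}"


section \<open>The vortex profile and the quadratic functional\<close>

text \<open>\<open>W'\<close> is the derivative of the potential.  Values of \<open>f\<close> outside \<open>[0,1]\<close> are
  irrelevant.\<close>

definition vortex_profile :: "nat \<Rightarrow> (real \<Rightarrow> real) \<Rightarrow> real \<Rightarrow> (real \<Rightarrow> real) \<Rightarrow> bool" where
  "vortex_profile N W' \<epsilon> f \<longleftrightarrow>
     continuous_on {0..1} f \<and> f 0 = 0 \<and> f 1 = 1 \<and>
     (\<exists>f' f''. \<forall>r\<in>{0<..<1}.
        (f has_real_derivative f' r) (at r) \<and>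
        (f' has_real_derivative f'' r) (at r) \<and>
        - f'' r - (real N - 1) / r * f' r + (real N - 1) / r\<^sup>2 * f r
          = 1 / \<epsilon>\<^sup>2 * (f r * W' (1 - (f r)\<^sup>2)))"

text \<open>The second variation, with \<open>f\<close> the profile for \<open>\<epsilon>\<close>, for fields \<open>V\<close> of class
  \<open>C\<^sup>1\<close>, whose weak gradient is the classical Jacobian.  The norm on \<open>real^'n^'n\<close> is the Frobenius norm.\<close>

definition second_variation ::
  "(real \<Rightarrow> real) \<Rightarrow> real \<Rightarrow> (real \<Rightarrow> real) \<Rightarrow> (real^'n \<Rightarrow> real^'n) \<Rightarrow> real" where
  "second_variation W' \<epsilon> f V =
     1 / 2 * (LINT x:ball 0 1|lebesgue.
        (norm (jacobian V (at x)))\<^sup>2 - 1 / \<epsilon>\<^sup>2 * W' (1 - (f (norm x))\<^sup>2) * (norm (V x))\<^sup>2)"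

end

theory Submission
  imports Defs "HOL-Computational_Algebra.Polynomial"
begin

text \<open>Let \<open>c\<close> be the smallest modulus with \<open>W'(1 - c\<^sup>2) = 0\<close>; \<open>c = 1\<close> unless \<open>W\<close> vanishes to the right
  of \<open>0\<close>.  A comparison argument gives \<open>\<bar>f\<^sub>\<epsilon>\<bar> \<le> c\<close> on \<open>(0, c/2]\<close> for every \<open>\<epsilon>\<close>, so there the potential
  \<open>q\<^sub>\<epsilon> = W'(1 - f\<^sub>\<epsilon>\<^sup>2)/\<epsilon>\<^sup>2\<close> is nonnegative, and it is at least of order \<open>1/\<epsilon>\<^sup>2\<close> wherever \<open>f\<^sub>\<epsilon>\<^sup>2\<close> stays away from \<open>c\<^sup>2\<close>.
  Testing the profile equation with \<open>f\<^sub>\<epsilon> \<eta>\<^sup>2\<close> shows that \<open>q\<^sub>\<epsilon>\<close> is asymptotically at least \<open>(N - 1)/r\<^sup>2\<close>,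
  up to derivatives of \<open>\<eta>\<close>.

  For \<open>v = x\<^sub>i r\<^sup>-\<^sup>a h(ln r)\<close> with \<open>a = (N - 2)/2\<close>, both terms of the energy become integrals over \<open>t = ln r\<close>
  with constant coefficients.  If \<open>h\<close> varies slowly, the derivatives of \<open>h\<close> are negligible, and the
  coefficients of \<open>h\<^sup>2\<close> in the Hessian term (\<open>0\<close> for \<open>N = 2\<close>, \<open>25/16\<close> for \<open>N = 3\<close>) are smaller than
  the lower bound \<open>(N - 1)\<^sup>2\<close> of those in the potential term.  Here \<open>h\<close> is a stretched copy of
  \<open>exp (- 1/s - 1/(1 - s))\<close>, so \<open>v\<close> is itself a test function.\<close>

section \<open>Smooth functions supported in an annulus\<close>

text \<open>Polynomial factors in \<open>1 / t\<close> are included because differentiating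
  \<open>exp (- (1 / t))\<close> produces them; \<open>p = 1\<close> is the classical flat
  function.\<close>

definition flat :: "real poly \<Rightarrow> real \<Rightarrow> real" where
  "flat p t = (if 0 < t then poly p (1 / t) * exp (- (1 / t)) else 0)"

text \<open>Under \<open>t = 1 / s\<close> this is the decay of \<open>s ^ n * exp (- s)\<close> at
  infinity, monomial by monomial; to the left of 0 the function is identically 0.\<close>

lemma flat_tendsto_0: "(flat p \<longlongrightarrow> 0) (at 0)"
proof -
  have "((\<lambda>t::real. t ^ n * exp (- t)) \<longlongrightarrow> 0) at_top" for n
    using tendsto_power_div_exp_0[of n] by (simp add: exp_minus divide_inverse)
  then have "((\<lambda>t::real. \<Sum>i\<le>degree p. coeff p i * (t ^ i * exp (- t))) \<longlongrightarrow> 0) at_top"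
    by (intro tendsto_null_sum tendsto_mult_right_zero)
  then have *: "((\<lambda>t. poly p t * exp (- t)) \<longlongrightarrow> 0) at_top"
    by (simp add: poly_altdef sum_distrib_right mult.assoc)
  have "((\<lambda>t. poly p (inverse t) * exp (- inverse t)) \<longlongrightarrow> 0) (at_right 0)"
    by (rule filterlim_compose[OF * filterlim_inverse_at_top_right])
  then have "(flat p \<longlongrightarrow> 0) (at_right 0)"
    by (rule Lim_transform_eventually)
      (auto simp: eventually_at_filter flat_def divide_inverse)
  moreover have "(flat p \<longlongrightarrow> 0) (at_left 0)"
    by (rule Lim_transform_eventually[where f = "\<lambda>_. 0"])
      (auto simp: eventually_at_filter flat_def)
  ultimately show ?thesis
    by (simp add: filterlim_split_at)
qed

text \<open>For \<open>t > 0\<close>, differentiating either factor brings out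
  \<open>1 / t^2\<close>, which is the polynomial \<open>[:0, 0, 1:]\<close> evaluated at
  \<open>1 / t\<close>.\<close>

lemma flat_has_derivative:
  "(flat p has_real_derivative flat ([:0, 0, 1:] * (p - pderiv p)) t) (at t)"
proof -
  consider "0 < t" | "t < 0" | "t = 0" by linarith
  then show ?thesis
  proof cases
    case 1
    have "((\<lambda>t. poly p (1 / t) * exp (- (1 / t))) has_real_derivative
        flat ([:0, 0, 1:] * (p - pderiv p)) t) (at t)"
      using 1 by (auto intro!: derivative_eq_intros simp: flat_def field_simps power2_eq_square)
    then show ?thesis
      by (rule has_field_derivative_transform_within_open[where S = "{0<..}"])
        (use 1 in \<open>auto simp: flat_def\<close>)
  next
    case 2
    have "((\<lambda>_. 0) has_real_derivative flat ([:0, 0, 1:] * (p - pderiv p)) t) (at t)"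
      using 2 by (simp add: flat_def)
    then show ?thesis
      by (rule has_field_derivative_transform_within_open[where S = "{..<0}"])
        (use 2 in \<open>auto simp: flat_def\<close>)
  next
    case 3
    \<comment> \<open>Dividing by \<open>h\<close> multiplies the polynomial by its variable, so the
      difference quotient at 0 stays in the family and tends to 0. At \<open>h = 0\<close> both
      sides are 0 because division by zero gives 0.\<close>
    have "(\<lambda>h. (flat p (0 + h) - flat p 0) / h) = flat (pCons 0 p)"
      by (auto simp: flat_def fun_eq_iff)
    then show ?thesis
      using flat_tendsto_0[of "pCons 0 p"] 3 by (simp add: DERIV_def flat_def)
  qed
qed

text \<open>The linear span of products that are flat at both ends of the unit interval. It is
  closed under differentiation, so a single derivative lemma yields smoothness of every
  order.\<close>

inductive_set smooth_bump :: "(real \<Rightarrow> real) set" where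
  flat: "(\<lambda>s. flat p s * flat q (1 - s)) \<in> smooth_bump"
| add: "u \<in> smooth_bump \<Longrightarrow> v \<in> smooth_bump \<Longrightarrow> (\<lambda>s. u s + v s) \<in> smooth_bump"
| scale: "u \<in> smooth_bump \<Longrightarrow> (\<lambda>s. c * u s) \<in> smooth_bump"

lemma smooth_bump_derivative:
  assumes "u \<in> smooth_bump"
  obtains u' where "u' \<in> smooth_bump" "\<And>s. (u has_real_derivative u' s) (at s)"
proof -
  have "\<exists>u'\<in>smooth_bump. \<forall>s. (u has_real_derivative u' s) (at s)"
    using assms
  proof induction
    case (flat p q)
    define P Q where "P = [:0, 0, 1:] * (p - pderiv p)" and "Q = [:0, 0, 1:] * (q - pderiv q)"
    have "((\<lambda>s. flat p s * flat q (1 - s)) has_real_derivative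
        flat P s * flat q (1 - s) + (-1) * (flat p s * flat Q (1 - s))) (at s)" for s
    proof -
      have "((\<lambda>s. flat q (1 - s)) has_real_derivative - flat Q (1 - s)) (at s)"
      proof -
        have "((\<lambda>s. 1 - s) has_real_derivative -1) (at s)"
          by (auto intro!: derivative_eq_intros)
        from DERIV_chain2[where f = "flat q" and g = "\<lambda>s. 1 - s", OF flat_has_derivative this]
        show ?thesis by (simp add: Q_def)
      qed
      from DERIV_mult'[OF flat_has_derivative[of p s] this]
      show ?thesis by (simp add: P_def add.commute)
    qed
    then show ?case
      by (intro bexI[of _ "\<lambda>s. flat P s * flat q (1 - s) + (-1) * (flat p s * flat Q (1 - s))"]
          allI smooth_bump.intros)
  next
    case (add u v)
    then obtain u' v' where "u' \<in> smooth_bump" "v' \<in> smooth_bump"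
      "\<forall>s. (u has_real_derivative u' s) (at s)" "\<forall>s. (v has_real_derivative v' s) (at s)" by blast
    then show ?case
      by (intro bexI[of _ "\<lambda>s. u' s + v' s"]) (auto intro!: derivative_intros smooth_bump.add)
  next
    case (scale u c)
    then obtain u' where "u' \<in> smooth_bump" "\<forall>s. (u has_real_derivative u' s) (at s)" by blast
    then show ?case
      by (intro bexI[of _ "\<lambda>s. c * u' s"])
        (auto intro!: derivative_eq_intros smooth_bump.scale)
  qed
  then obtain u' where "u' \<in> smooth_bump" "\<forall>s. (u has_real_derivative u' s) (at s)" by blast
  then show thesis by (intro that) auto
qed

lemma smooth_bump_support: "u \<in> smooth_bump \<Longrightarrow> s \<notin> {0<..<1} \<Longrightarrow> u s = 0"
  by (induction rule: smooth_bump.induct) (auto simp: flat_def)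

text \<open>Away from the origin this is the chain rule with gradient \<open>x / r^2\<close> of
  \<open>ln r\<close>. Near the origin the function vanishes identically:
  \<open>ln r \<le> A\<close> for small positive \<open>r\<close>, and the value at the origin
  itself is \<open>\<phi> 0\<close> since \<open>ln 0 = 0\<close>.\<close>

lemma log_radial_has_derivative:
  fixes x :: "'a::euclidean_space"
  assumes \<phi>: "\<And>t. (\<phi> has_real_derivative \<phi>' t) (at t)"
    and zero: "\<And>t. t \<le> A \<Longrightarrow> \<phi> t = 0" "\<phi> 0 = 0"
  shows "((\<lambda>x. \<phi> (ln (norm x))) has_derivative
    (\<lambda>w. w \<bullet> ((exp (- 2 * ln (norm x)) * \<phi>' (ln (norm x))) *\<^sub>R x))) (at x)"
proof (cases "x = 0")
  case True
  have "((\<lambda>_. 0) has_derivative (\<lambda>w. w \<bullet> ((exp (- 2 * ln (norm x)) * \<phi>' (ln (norm x))) *\<^sub>R x))) (at x)"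
    using True by simp
  then show ?thesis
  proof (rule has_derivative_transform_within_open[where s = "ball 0 (exp A)"])
    fix y :: 'a assume y: "y \<in> ball 0 (exp A)"
    show "0 = \<phi> (ln (norm y))"
    proof (cases "y = 0")
      case False
      then have "ln (norm y) \<le> ln (exp A)"
        using y by (subst ln_le_cancel_iff) auto
      then show ?thesis by (simp add: zero)
    qed (simp add: zero)
  qed (use True in auto)
next
  case False
  have e: "exp (- 2 * ln (norm x)) = 1 / (norm x)\<^sup>2"
  proof -
    have "exp (- 2 * ln (norm x)) = exp (- (ln (norm x) + ln (norm x)))" by simp
    also have "\<dots> = 1 / (norm x)\<^sup>2"
      using False by (simp only: exp_minus exp_add exp_ln zero_less_norm_iff not_False_eq_True)
        (simp add: power2_eq_square divide_inverse)
    finally show ?thesis .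
  qed
  have "((\<lambda>x. ln (norm x)) has_derivative (\<lambda>w. w \<bullet> x / (norm x)\<^sup>2)) (at x)"
    by (rule has_derivative_eq_rhs[OF has_derivative_ln[OF _ has_derivative_norm]])
      (use False in \<open>auto simp: sgn_div_norm field_simps power2_eq_square inner_commute\<close>)
  from has_derivative_compose[OF this \<phi>[unfolded has_field_derivative_def]]
  show ?thesis unfolding e by (rule has_derivative_eq_rhs) (simp add: fun_eq_iff)
qed

text \<open>Since \<open>ln 0 = 0\<close>, the value at the origin is \<open>u (- A / L)\<close>; it vanishes for a bump \<open>u\<close>
  as soon as \<open>A + L < 0\<close>.\<close>

definition log_radial :: "real \<Rightarrow> real \<Rightarrow> real \<Rightarrow> (real \<Rightarrow> real) \<Rightarrow> 'a::euclidean_space \<Rightarrow> real" where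
  "log_radial A L b u x = exp (b * ln (norm x)) * u ((ln (norm x) - A) / L)"

text \<open>Differentiating a radial factor gives another radial factor times a coordinate, so
  closure under \<open>coord\<close> is what makes the class stable under partial
  derivatives.\<close>

inductive_set annular :: "real \<Rightarrow> real \<Rightarrow> ('a::euclidean_space \<Rightarrow> real) set" for A L where
  radial: "u \<in> smooth_bump \<Longrightarrow> log_radial A L b u \<in> annular A L"
| add: "f \<in> annular A L \<Longrightarrow> g \<in> annular A L \<Longrightarrow> (\<lambda>x. f x + g x) \<in> annular A L"
| coord: "f \<in> annular A L \<Longrightarrow> (\<lambda>x. (x \<bullet> e) * f x) \<in> annular A L"
| scale: "f \<in> annular A L \<Longrightarrow> (\<lambda>x. c * f x) \<in> annular A L"

text \<open>Differentiating \<open>exp (b * t) * u ((t - A) / L)\<close> in \<open>t\<close> keeps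
  its shape; the factor \<open>r^-2\<close> from the gradient of \<open>ln r\<close> lowers the
  exponent to \<open>b - 2\<close>.\<close>

lemma log_radial_has_derivative_bump:
  assumes L: "0 < L" "A + L < 0" and u: "u \<in> smooth_bump"
    and u': "\<And>s. (u has_real_derivative u' s) (at s)"
  shows "(log_radial A L b u has_derivative
    (\<lambda>w. w \<bullet> (log_radial A L (b - 2) (\<lambda>s. b * u s + (1 / L) * u' s) x *\<^sub>R x))) (at x)"
proof -
  define \<phi> where "\<phi> t = exp (b * t) * u ((t - A) / L)" for t
  define \<phi>' where "\<phi>' t = exp (b * t) * (b * u ((t - A) / L) + (1 / L) * u' ((t - A) / L))" for t
  have d: "(\<phi> has_real_derivative \<phi>' t) (at t)" for t
  proof -
    have "((\<lambda>t. u ((t - A) / L)) has_real_derivative u' ((t - A) / L) * (1 / L)) (at t)"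
      by (rule DERIV_chain2[OF u']) (use L in \<open>auto intro!: derivative_eq_intros\<close>)
    then show ?thesis unfolding \<phi>_def \<phi>'_def
      by (auto intro!: derivative_eq_intros simp: algebra_simps)
  qed
  have z: "\<phi> t = 0" if "t \<le> A" for t
  proof -
    have "(t - A) / L \<le> 0" using that L by (simp add: divide_le_0_iff)
    then show ?thesis using smooth_bump_support[OF u, of "(t - A) / L"] by (simp add: \<phi>_def)
  qed
  have z0: "\<phi> 0 = 0"
  proof -
    have "1 \<le> (0 - A) / L" using L by (simp add: le_divide_eq divide_le_eq)
    then show ?thesis using smooth_bump_support[OF u, of "(0 - A) / L"] by (simp add: \<phi>_def)
  qed
  have "exp (- 2 * ln (norm x)) * \<phi>' (ln (norm x)) =
      log_radial A L (b - 2) (\<lambda>s. b * u s + (1 / L) * u' s) x"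
  proof -
    have "exp ((b - 2) * t) = exp (- 2 * t) * exp (b * t)" for t :: real
      by (simp add: algebra_simps flip: exp_add)
    then show ?thesis unfolding \<phi>'_def log_radial_def by (simp only: mult.assoc)
  qed
  then show ?thesis
    using log_radial_has_derivative[of \<phi> \<phi>' A x, OF d z z0]
    by (simp add: log_radial_def[abs_def] \<phi>_def)
qed

text \<open>All components of the gradient lie in the class again, so the lemma can be iterated to
  reach any order of differentiability.\<close>

lemma annular_derivative:
  fixes f :: "'a::euclidean_space \<Rightarrow> real"
  assumes L: "0 < L" "A + L < 0" and f: "f \<in> annular A L"
  obtains G where "\<And>e. (\<lambda>x. G x \<bullet> e) \<in> annular A L" "\<And>x. (f has_derivative (\<lambda>w. w \<bullet> G x)) (at x)"
proof -
  have "\<exists>G. (\<forall>e. (\<lambda>x. G x \<bullet> e) \<in> annular A L) \<and> (\<forall>x. (f has_derivative (\<lambda>w. w \<bullet> G x)) (at x))"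
    using f
  proof induction
    case (radial u b)
    obtain u' where u': "u' \<in> smooth_bump" "\<And>s. (u has_real_derivative u' s) (at s)"
      using smooth_bump_derivative[OF radial] by metis
    have m: "log_radial A L (b - 2) (\<lambda>s. b * u s + (1 / L) * u' s) \<in> annular A L"
      by (intro annular.radial smooth_bump.intros radial u')
    show ?case
      using annular.coord[OF m]
      by (intro exI[of _ "\<lambda>x. log_radial A L (b - 2) (\<lambda>s. b * u s + (1 / L) * u' s) x *\<^sub>R x"]
          conjI allI log_radial_has_derivative_bump[OF L radial u'(2)]) (simp add: mult.commute)
  next
    case (add f g)
    then obtain F G where
      "\<And>e. (\<lambda>x. F x \<bullet> e) \<in> annular A L" "\<And>x. (f has_derivative (\<lambda>w. w \<bullet> F x)) (at x)"
      "\<And>e. (\<lambda>x. G x \<bullet> e) \<in> annular A L" "\<And>x. (g has_derivative (\<lambda>w. w \<bullet> G x)) (at x)" by blast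
    then show ?case
      by (intro exI[of _ "\<lambda>x. F x + G x"] conjI allI)
        (auto simp: inner_add_left inner_add_right intro!: annular.add has_derivative_add)
  next
    case (coord f e)
    then obtain F where
      F: "\<And>e. (\<lambda>x. F x \<bullet> e) \<in> annular A L" "\<And>x. (f has_derivative (\<lambda>w. w \<bullet> F x)) (at x)" by blast
    have "((\<lambda>x. (x \<bullet> e) * f x) has_derivative (\<lambda>w. w \<bullet> ((x \<bullet> e) *\<^sub>R F x + f x *\<^sub>R e))) (at x)" for x
      by (rule has_derivative_eq_rhs, rule has_derivative_mult[OF _ F(2)])
        (auto intro!: derivative_eq_intros simp: inner_add_right fun_eq_iff)
    moreover have "(\<lambda>x. ((x \<bullet> e) *\<^sub>R F x + f x *\<^sub>R e) \<bullet> d) \<in> annular A L" for d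
      using annular.add[OF annular.coord[OF F(1)[of d]] annular.scale[OF coord.hyps, of "e \<bullet> d"]]
      by (simp add: inner_add_left mult.commute)
    ultimately show ?case
      by (intro exI[of _ "\<lambda>x. (x \<bullet> e) *\<^sub>R F x + f x *\<^sub>R e"] conjI allI)
  next
    case (scale f c)
    then obtain F where
      "\<And>e. (\<lambda>x. F x \<bullet> e) \<in> annular A L" "\<And>x. (f has_derivative (\<lambda>w. w \<bullet> F x)) (at x)" by blast
    then show ?case
      by (intro exI[of _ "\<lambda>x. c *\<^sub>R F x"] conjI allI)
        (auto intro!: annular.scale derivative_eq_intros)
  qed
  then obtain G where "\<forall>e. (\<lambda>x. G x \<bullet> e) \<in> annular A L" "\<forall>x. (f has_derivative (\<lambda>w. w \<bullet> G x)) (at x)" by blast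
  then show thesis by (intro that) auto
qed

lemma annular_cont_diff:
  assumes L: "0 < L" "A + L < 0" and f: "f \<in> annular A L"
  shows "cont_diff k f"
  using f
proof (induction k arbitrary: f)
  case 0
  obtain G where "\<And>x. (f has_derivative (\<lambda>w. w \<bullet> G x)) (at x)"
    using annular_derivative[OF L 0] by metis
  then show ?case
    by (auto intro!: continuous_at_imp_continuous_on has_derivative_continuous)
next
  case (Suc k)
  obtain G where G: "\<And>e. (\<lambda>x. G x \<bullet> e) \<in> annular A L" "\<And>x. (f has_derivative (\<lambda>w. w \<bullet> G x)) (at x)"
    using annular_derivative[OF L Suc.prems] by metis
  have "frechet_derivative f (at x) = (\<lambda>w. w \<bullet> G x)" for x
    using frechet_derivative_at[OF G(2)] by metis
  with G Suc.IH show ?case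
    by (auto simp: inner_commute intro: differentiableI)
qed

lemma annular_support:
  assumes L: "0 < L" "A + L < 0" and f: "f \<in> annular A L" and x: "f x \<noteq> 0"
  shows "norm x \<in> {exp A..exp (A + L)}"
proof (rule ccontr)
  assume n: "norm x \<notin> {exp A..exp (A + L)}"
  \<comment> \<open>The origin needs its own case: \<open>ln 0 = 0\<close> makes the argument
    \<open>- A / L\<close>, which exceeds 1.\<close>
  have "(ln (norm x) - A) / L \<notin> {0<..<1}"
  proof (cases "x = 0")
    case True
    then show ?thesis using L by (simp add: field_simps)
  next
    case False
    then have "norm x = exp (ln (norm x))" by simp
    then have "ln (norm x) < A \<or> A + L < ln (norm x)"
      using n by (metis atLeastAtMost_iff exp_le_cancel_iff not_le)
    then show ?thesis using L by (auto simp: field_simps)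
  qed
  from f this have "f x = 0"
    by (induction) (auto simp: log_radial_def smooth_bump_support)
  with x show False by simp
qed

lemma annular_Cc:
  fixes f :: "'a::euclidean_space \<Rightarrow> real"
  assumes L: "0 < L" "A + L < 0" and f: "f \<in> annular A L"
  shows "f \<in> Cc k (ball 0 1 - {0})"
proof -
  let ?K = "cball 0 (exp (A + L)) - ball (0::'a) (exp A)"
  have K: "compact ?K" by (intro compact_diff) auto
  have "closure {x. f x \<noteq> 0} \<subseteq> ?K"
    using annular_support[OF L f] by (intro closure_minimal compact_imp_closed[OF K]) fastforce
  moreover have "?K \<subseteq> ball 0 1 - {0}"
  proof -
    have "exp (A + L) < 1" using L by simp
    then show ?thesis by (auto simp del: exp_less_one_iff)
  qed
  moreover have "compact (closure {x. f x \<noteq> 0})"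
    using bounded_subset[OF compact_imp_bounded[OF K]] closure_subset calculation(1)
    by (metis compact_closure order_trans)
  ultimately show ?thesis
    using annular_cont_diff[OF L f] unfolding Cc_def by blast
qed

section \<open>Gradients, Hessians and membership in \<open>H20_ball\<close>\<close>

lemma grad_eq:
  assumes "(u has_derivative (\<lambda>w. w \<bullet> G)) (at x)"
  shows "grad u x = G"
  using frechet_derivative_at[OF assms, symmetric] by (simp add: grad_def vec_eq_iff inner_axis')

lemma jacobian_eq:
  fixes G :: "real^'n \<Rightarrow> real^'m"
  assumes "\<And>j. ((\<lambda>x. G x $ j) has_derivative (\<lambda>w. w \<bullet> D j)) (at x)"
  shows "jacobian G (at x) = (\<chi> j. D j)"
proof -
  have "(G has_derivative (\<lambda>w. \<chi> j. w \<bullet> D j)) (at x)"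
    by (subst has_derivative_componentwise_within) (use assms in \<open>auto simp: Basis_vec_def inner_axis\<close>)
  from frechet_derivative_at[OF this, symmetric]
  show ?thesis
    by (simp add: jacobian_def matrix_def vec_eq_iff inner_axis')
qed

text \<open>\<open>T\<close> is the Hessian at \<open>x\<close> of \<open>x $ i\<close> times a
  radial function whose gradient is \<open>p\<close> times \<open>x\<close>, where the radial
  function \<open>p\<close> in turn has gradient \<open>s\<close> times \<open>x\<close>.\<close>

lemma norm_hessian_sq:
  fixes x :: "real^'n" and i :: 'n and p s :: real and T :: "real^'n^'n"
  defines "T \<equiv> \<chi> j k. p * ((if j = i then x $ k else 0) + (if k = i then x $ j else 0)
    + (if j = k then x $ i else 0)) + s * (x $ i * x $ j * x $ k)"
  shows "(norm T)\<^sup>2 = 2 * p\<^sup>2 * (norm x)\<^sup>2 + (x $ i)\<^sup>2 * ((real CARD('n) + 6) * p\<^sup>2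
    + 6 * p * s * (norm x)\<^sup>2 + s\<^sup>2 * ((norm x)\<^sup>2)\<^sup>2)"
proof -
  let ?d = "\<lambda>j. if j = i then 1 else 0 :: real"
  \<comment> \<open>Row \<open>j\<close> is a combination of \<open>x\<close>,
    \<open>axis i 1\<close> and \<open>axis j 1\<close>, so its norm involves only the inner
    products of these three vectors.\<close>
  define R where "R j = (p * ?d j + s * x $ i * x $ j) *\<^sub>R x + (p * x $ j) *\<^sub>R axis i 1
    + (p * x $ i) *\<^sub>R axis j 1" for j
  have row: "T $ j = R j" for j
    by (simp add: T_def R_def vec_eq_iff axis_def algebra_simps)
  have R: "(norm (R j))\<^sup>2 = p\<^sup>2 * (norm x)\<^sup>2 * ?d j + (p\<^sup>2 + s\<^sup>2 * (x $ i)\<^sup>2 * (norm x)\<^sup>2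
      + 4 * p * s * (x $ i)\<^sup>2) * (x $ j)\<^sup>2 + p\<^sup>2 * (x $ i)\<^sup>2
      + (6 * p\<^sup>2 * (x $ i)\<^sup>2 + 2 * p * s * (x $ i)\<^sup>2 * (norm x)\<^sup>2) * ?d j" for j
  proof -
    have ax: "axis i 1 \<bullet> (axis j 1 :: real^'n) = ?d j" "axis j 1 \<bullet> (axis i 1 :: real^'n) = ?d j"
      "axis k 1 \<bullet> (axis k 1 :: real^'n) = 1" for k
      by (auto simp: inner_axis_axis)
    have xk: "x \<bullet> axis k 1 = x $ k" "axis k 1 \<bullet> x = x $ k" for k
      by (simp_all add: inner_axis inner_axis')
    have "(norm (R j))\<^sup>2 = R j \<bullet> R j" by (simp add: power2_norm_eq_inner)
    also have "\<dots> = (p * ?d j + s * x $ i * x $ j)\<^sup>2 * (x \<bullet> x) + (p * x $ j)\<^sup>2 + (p * x $ i)\<^sup>2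
        + 2 * ((p * ?d j + s * x $ i * x $ j) * (p * x $ j) * x $ i)
        + 2 * ((p * ?d j + s * x $ i * x $ j) * (p * x $ i) * x $ j)
        + 2 * ((p * x $ j) * (p * x $ i) * ?d j)"
      unfolding R_def
      by (simp add: inner_add_left inner_add_right ax xk power2_eq_square distrib_left distrib_right mult_ac)
    finally show ?thesis
      unfolding power2_norm_eq_inner by (simp add: power2_eq_square algebra_simps)
  qed
  have n: "(\<Sum>j\<in>UNIV. (x $ j)\<^sup>2) = (norm x)\<^sup>2"
    by (simp add: norm_vec_def L2_set_def sum_nonneg)
  have "(norm T)\<^sup>2 = (\<Sum>j\<in>UNIV. (norm (R j))\<^sup>2)"
    unfolding norm_vec_def[of T] L2_set_def row by (simp add: sum_nonneg)
  also have "\<dots> = p\<^sup>2 * (norm x)\<^sup>2 + (p\<^sup>2 + s\<^sup>2 * (x $ i)\<^sup>2 * (norm x)\<^sup>2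
      + 4 * p * s * (x $ i)\<^sup>2) * (norm x)\<^sup>2 + CARD('n) * (p\<^sup>2 * (x $ i)\<^sup>2)
      + (6 * p\<^sup>2 * (x $ i)\<^sup>2 + 2 * p * s * (x $ i)\<^sup>2 * (norm x)\<^sup>2)"
    unfolding R sum.distrib sum_distrib_left[symmetric] n by simp
  finally show ?thesis by (simp add: power2_eq_square algebra_simps)
qed

lemma continuous_imp_measurable_on_ball:
  assumes "continuous_on UNIV u"
  shows "u \<in> borel_measurable (lebesgue_on (ball 0 1))"
  by (rule continuous_imp_measurable_on_sets_lebesgue[OF continuous_on_subset[OF assms]]) auto

text \<open>Since \<open>v\<close> is itself a test function, the constant sequence approximates it
  at distance 0. Only measurability of \<open>v\<close>, its gradient and its Hessian remains, and
  it follows from continuity.\<close>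

lemma annular_H20:
  fixes v :: "real^'n \<Rightarrow> real"
  assumes L: "0 < L" "A + L < 0" and v: "v \<in> annular A L"
  shows "v \<in> H20_ball"
proof -
  have cont: "continuous_on UNIV u" if "u \<in> annular A L" for u :: "real^'n \<Rightarrow> real"
    using annular_cont_diff[OF L that, of 0] by simp
  obtain G where G: "\<And>e. (\<lambda>x. G x \<bullet> e) \<in> annular A L" "\<And>x. (v has_derivative (\<lambda>w. w \<bullet> G x)) (at x)"
    using annular_derivative[OF L v] by metis
  have gradG: "grad v = G" using grad_eq[OF G(2)] by auto
  have cG: "continuous_on UNIV G"
    using cont[OF G(1)] by (subst continuous_on_componentwise) auto
  have "\<exists>D. \<forall>j. (\<forall>e. (\<lambda>x. D j x \<bullet> e) \<in> annular A L) \<and>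
      (\<forall>x. ((\<lambda>x. G x $ j) has_derivative (\<lambda>w. w \<bullet> D j x)) (at x))"
  proof (rule choice, rule allI)
    fix j
    have "(\<lambda>x. G x $ j) \<in> annular A L" using G(1)[of "axis j 1"] by (simp add: inner_axis)
    then show "\<exists>D. (\<forall>e. (\<lambda>x. D x \<bullet> e) \<in> annular A L) \<and>
      (\<forall>x. ((\<lambda>x. G x $ j) has_derivative (\<lambda>w. w \<bullet> D x)) (at x))"
      using annular_derivative[OF L] by metis
  qed
  then obtain D where D: "\<And>j e. (\<lambda>x. D j x \<bullet> e) \<in> annular A L"
    "\<And>j x. ((\<lambda>x. G x $ j) has_derivative (\<lambda>w. w \<bullet> D j x)) (at x)" by blast
  have hessD: "hess v = (\<lambda>x. \<chi> j. D j x)"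
    unfolding hess_def gradG by (intro ext jacobian_eq D(2))
  have cD: "continuous_on UNIV (\<lambda>x. \<chi> j. D j x)"
    by (intro continuous_on_vec_lambda) (subst continuous_on_componentwise, use cont[OF D(1)] in auto)
  have "v \<in> Cc_smooth (ball 0 1)"
    using annular_Cc[OF L v] unfolding Cc_smooth_def Cc_def by blast
  then show ?thesis
    unfolding H20_ball_def L2_converges_def
    by (intro CollectI exI[of _ "\<lambda>_. v"] exI[of _ "grad v"] exI[of _ "hess v"])
      (use continuous_imp_measurable_on_ball[OF cont[OF v]] continuous_imp_measurable_on_ball[OF cG] continuous_imp_measurable_on_ball[OF cD] in \<open>auto simp: gradG hessD\<close>)
qed

section \<open>Integration in logarithmic polar coordinates\<close>

text \<open>Both measures give a closed interval \<open>{a..b}\<close> the volume of the annulus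
  between the radii \<open>exp a\<close> and \<open>exp b\<close>, and such intervals form an
  intersection-stable generator of the Borel sets.\<close>

lemma distr_ln_norm:
  "distr lborel borel (\<lambda>x::'a::euclidean_space. ln (norm x)) =
    density lborel (\<lambda>t. ennreal (DIM('a) * unit_ball_vol DIM('a) * exp (DIM('a) * t)))"
    (is "?M = ?N")
proof (rule measure_eqI_generator_eq)
  let ?E = "range (\<lambda>(a, b). {a..b::real})"
  let ?A = "\<lambda>i::nat. {- real i..real i}"
  let ?n = "DIM('a)" and ?\<omega> = "unit_ball_vol DIM('a)"
  have eq: "emeasure ?M {a..b} = ennreal (?\<omega> * exp (?n * b) - ?\<omega> * exp (?n * a))"
    "emeasure ?N {a..b} = ennreal (?\<omega> * exp (?n * b) - ?\<omega> * exp (?n * a))" if "a \<le> b" for a b :: real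
  proof -
    have "emeasure ?M {a..b} = emeasure lborel ((\<lambda>x::'a. ln (norm x)) -` {a..b})"
      by (subst emeasure_distr) auto
    also have "\<dots> = emeasure lborel (cball (0::'a) (exp b) - ball 0 (exp a))"
    proof (rule emeasure_eq_AE)
      \<comment> \<open>The two sets can differ only at the origin, where \<open>ln 0 = 0\<close>
        may fall into the interval.\<close>
      show "AE x::'a in lborel. x \<in> (\<lambda>x. ln (norm x)) -` {a..b} \<longleftrightarrow> x \<in> cball 0 (exp b) - ball 0 (exp a)"
        using AE_lborel_singleton[of "0::'a"]
      proof eventually_elim
        case (elim x)
        then have "a \<le> ln (norm x) \<longleftrightarrow> exp a \<le> norm x" "ln (norm x) \<le> b \<longleftrightarrow> norm x \<le> exp b"
          using exp_le_cancel_iff[of a "ln (norm x)"] exp_le_cancel_iff[of "ln (norm x)" b] by auto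
        then show ?case by auto
      qed
      show "(\<lambda>x::'a. ln (norm x)) -` {a..b} \<in> sets lborel"
        using measurable_sets[of "\<lambda>x::'a. ln (norm x)" borel borel "{a..b}"] by simp
    qed auto
    also have "\<dots> = emeasure lborel (cball (0::'a) (exp b)) - emeasure lborel (ball (0::'a) (exp a))"
    proof (rule emeasure_Diff)
      have "exp a \<le> exp b" using that by simp
      from subset_trans[OF ball_subset_cball subset_cball[OF this]]
      show "ball (0::'a) (exp a) \<subseteq> cball 0 (exp b)" .
    qed (use emeasure_lborel_ball_finite[of "0::'a" "exp a"] in auto)
    also have "\<dots> = ennreal (?\<omega> * exp (?n * b) - ?\<omega> * exp (?n * a))"
      using that by (simp add: emeasure_ball emeasure_cball ennreal_minus exp_of_nat_mult)
    finally show "emeasure ?M {a..b} = ennreal (?\<omega> * exp (?n * b) - ?\<omega> * exp (?n * a))" .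
    have "emeasure ?N {a..b} = (\<integral>\<^sup>+t. ennreal (?n * ?\<omega> * exp (?n * t)) * indicator {a..b} t \<partial>lborel)"
      by (subst emeasure_density) auto
    also have "\<dots> = ennreal (?\<omega> * exp (?n * b) - ?\<omega> * exp (?n * a))"
      using that by (intro nn_integral_FTC_Icc) (auto intro!: derivative_eq_intros)
    finally show "emeasure ?N {a..b} = ennreal (?\<omega> * exp (?n * b) - ?\<omega> * exp (?n * a))" .
  qed
  show "Int_stable ?E"
    by (auto simp: Int_stable_def intro!: image_eqI[where x = "(max _ _, min _ _)"])
  show "emeasure ?M X = emeasure ?N X" if X: "X \<in> ?E" for X
  proof -
    from X obtain a b where X: "X = {a..b}" by auto
    show ?thesis
    proof (cases "a \<le> b")
      case True
      show ?thesis unfolding X using eq[OF True] by simp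
    qed (simp add: X)
  qed
  show "sets ?M = sigma_sets UNIV ?E" "sets ?N = sigma_sets UNIV ?E"
    by (simp_all add: borel_eq_atLeastAtMost)
  show "range ?A \<subseteq> ?E" by auto
  show "(\<Union>i. ?A i) = UNIV"
  proof -
    have "\<exists>i. x \<in> ?A i" for x
      using real_arch_simple[of "\<bar>x\<bar>"] by (auto simp: abs_le_iff minus_le_iff)
    then show ?thesis by auto
  qed
  show "emeasure ?M (?A i) \<noteq> \<infinity>" for i
    by (subst eq) auto
qed auto

lemma has_bochner_integral_log_radial:
  fixes G :: "real \<Rightarrow> real"
  assumes [measurable]: "G \<in> borel_measurable borel"
    and int: "integrable lborel (\<lambda>t. exp (DIM('a) * t) * G t)"
  shows "has_bochner_integral lborel (\<lambda>x::'a::euclidean_space. G (ln (norm x)))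
    (DIM('a) * unit_ball_vol DIM('a) * (\<integral>t. exp (DIM('a) * t) * G t \<partial>lborel))"
proof -
  let ?c = "real DIM('a) * unit_ball_vol DIM('a)"
  have "has_bochner_integral lborel (\<lambda>t. ?c * (exp (DIM('a) * t) * G t))
      (?c * (\<integral>t. exp (DIM('a) * t) * G t \<partial>lborel))"
    using int by (intro has_bochner_integral_mult_right has_bochner_integral_integrable)
  then have "has_bochner_integral lborel (\<lambda>t. (?c * exp (DIM('a) * t)) *\<^sub>R G t)
      (?c * (\<integral>t. exp (DIM('a) * t) * G t \<partial>lborel))"
    by (simp add: mult.assoc)
  then have "has_bochner_integral (density lborel (\<lambda>t. ennreal (?c * exp (DIM('a) * t)))) G
      (?c * (\<integral>t. exp (DIM('a) * t) * G t \<partial>lborel))"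
    by (intro has_bochner_integral_density) auto
  then show ?thesis
    unfolding distr_ln_norm[symmetric]
    by (simp add: has_bochner_integral_iff integrable_distr_eq integral_distr)
qed

section \<open>Integrals weighted by the square of a coordinate\<close>

lemma prod_Basis_cart: "(\<Prod>b\<in>Basis. f b) = (\<Prod>k\<in>UNIV. f (axis k 1 :: real^'n))"
proof -
  have "(Basis :: (real^'n) set) = range (\<lambda>k. axis k 1)" by (auto simp: Basis_vec_def)
  then show ?thesis
    by (metis (no_types, lifting) prod.reindex_cong axis_eq_axis injI zero_neq_one)
qed

text \<open>A swap of two coordinates maps boxes to boxes with the same product of edge lengths.
  This symmetry makes the second moments of a radial density equal in all coordinates.\<close>

lemma lborel_permute_coordinates:
  fixes i j :: "'n::finite"
  defines "T \<equiv> (\<lambda>x::real^'n. \<chi> k. x $ Transposition.transpose i j k)"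
  shows "distr lborel borel T = lborel"
proof (rule lborel_eqI[symmetric])
  have TT: "T (T x) = x" for x by (simp add: T_def vec_eq_iff)
  have "linear T" by (rule linearI) (simp_all add: T_def vec_eq_iff)
  then have [measurable]: "T \<in> borel_measurable borel"
    by (intro borel_measurable_continuous_onI linear_continuous_on) (simp add: linear_conv_bounded_linear)
  fix l u :: "real^'n" assume lu: "\<And>b. b \<in> Basis \<Longrightarrow> l \<bullet> b \<le> u \<bullet> b"
  have "T -` box l u = box (T l) (T u)"
    by (auto simp: T_def mem_box_cart) (metis transpose_involutory)+
  then have "emeasure (distr lborel borel T) (box l u) = emeasure lborel (box (T l) (T u))"
    by (simp add: emeasure_distr)
  also have "\<dots> = (\<Prod>k\<in>UNIV. (u - l) $ Transposition.transpose i j k)"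
  proof -
    have lu': "l $ k \<le> u $ k" for k
      using lu[of "axis k 1"] by (simp add: inner_axis)
    have "emeasure lborel (box (T l) (T u)) = ennreal (\<Prod>b\<in>Basis. (T u - T l) \<bullet> b)"
      using lu' by (intro emeasure_lborel_box) (auto simp: Basis_vec_def inner_axis T_def)
    also have "(\<Prod>b\<in>Basis. (T u - T l) \<bullet> b) = (\<Prod>k\<in>UNIV. (T u - T l) $ k)"
      by (simp add: prod_Basis_cart inner_axis)
    finally show ?thesis by (simp add: T_def)
  qed
  also have "(\<Prod>k\<in>UNIV. (u - l) $ Transposition.transpose i j k) = (\<Prod>k\<in>UNIV. (u - l) $ k)"
    by (rule prod.reindex_bij_betw) simp
  also have "\<dots> = (\<Prod>b\<in>Basis. (u - l) \<bullet> b)"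
    by (simp add: prod_Basis_cart inner_axis)
  finally show "emeasure (distr lborel borel T) (box l u) = (\<Prod>b\<in>Basis. (u - l) \<bullet> b)" .
qed simp

text \<open>By symmetry the integral with \<open>(x $ i)^2\<close> is \<open>1 / CARD('n)\<close>
  times the one with \<open>(norm x)^2\<close>; this cancels the dimension in front of
  \<open>unit_ball_vol\<close>, and \<open>(norm x)^2\<close> becomes
  \<open>exp (2 * t)\<close>.\<close>

lemma has_bochner_integral_coordinate_log_radial:
  fixes G :: "real \<Rightarrow> real" and i :: "'n::finite"
  assumes G[measurable]: "G \<in> borel_measurable borel"
    and int: "integrable lborel (\<lambda>t. exp ((real CARD('n) + 2) * t) * G t)"
  shows "has_bochner_integral lborel (\<lambda>x::real^'n. (x $ i)\<^sup>2 * G (ln (norm x)))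
    (unit_ball_vol CARD('n) * (\<integral>t. exp ((real CARD('n) + 2) * t) * G t \<partial>lborel))"
proof -
  let ?I = "\<integral>t. exp ((real CARD('n) + 2) * t) * G t \<partial>lborel"
  have e: "exp (real CARD('n) * t) * (exp (2 * t) * G t) = exp ((real CARD('n) + 2) * t) * G t" for t
    by (simp add: distrib_right exp_add)
  have "has_bochner_integral lborel (\<lambda>x::real^'n. exp (2 * ln (norm x)) * G (ln (norm x)))
      (CARD('n) * unit_ball_vol CARD('n) * ?I)"
  proof -
    have "has_bochner_integral lborel (\<lambda>x::real^'n. exp (2 * ln (norm x)) * G (ln (norm x)))
        (DIM(real^'n) * unit_ball_vol DIM(real^'n) *
          (\<integral>t. exp (DIM(real^'n) * t) * (exp (2 * t) * G t) \<partial>lborel))"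
      by (rule has_bochner_integral_log_radial) (use int in \<open>auto simp: e\<close>)
    then show ?thesis by (simp add: e)
  qed
  \<comment> \<open>Equality fails at the origin, where the left-hand exponential is 1 because
    \<open>ln 0 = 0\<close>.\<close>
  moreover have "AE x::real^'n in lborel. exp (2 * ln (norm x)) * G (ln (norm x)) = (norm x)\<^sup>2 * G (ln (norm x))"
    using AE_lborel_singleton[of "0::real^'n"] by eventually_elim (simp add: exp_double)
  ultimately have norm: "has_bochner_integral lborel (\<lambda>x::real^'n. (norm x)\<^sup>2 * G (ln (norm x)))
      (CARD('n) * unit_ball_vol CARD('n) * ?I)"
    by (subst (asm) has_bochner_integral_cong_AE) auto
  have integr: "integrable lborel (\<lambda>x::real^'n. (x $ k)\<^sup>2 * G (ln (norm x)))" for k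
  proof (rule Bochner_Integration.integrable_bound)
    show "integrable lborel (\<lambda>x::real^'n. (norm x)\<^sup>2 * G (ln (norm x)))"
      using norm by (simp add: has_bochner_integral_iff)
    show "AE x::real^'n in lborel. norm ((x $ k)\<^sup>2 * G (ln (norm x))) \<le> norm ((norm x)\<^sup>2 * G (ln (norm x)))"
    proof (intro AE_I2)
      fix x :: "real^'n"
      have "(x $ k)\<^sup>2 \<le> (norm x)\<^sup>2"
        using component_le_norm_cart[of x k] by (metis abs_le_square_iff abs_norm_cancel)
      then show "norm ((x $ k)\<^sup>2 * G (ln (norm x))) \<le> norm ((norm x)\<^sup>2 * G (ln (norm x)))"
        by (auto simp: abs_mult intro!: mult_right_mono)
    qed
  qed measurable
  have swap: "(\<integral>x. ((x::real^'n) $ k)\<^sup>2 * G (ln (norm x)) \<partial>lborel) = (\<integral>x. ((x::real^'n) $ i)\<^sup>2 * G (ln (norm x)) \<partial>lborel)" for k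
  proof -
    define T where "T x = (\<chi> l. x $ Transposition.transpose i k l)" for x :: "real^'n"
    have "linear T" by (rule linearI) (simp_all add: T_def vec_eq_iff)
    then have T[measurable]: "T \<in> borel_measurable borel"
      by (intro borel_measurable_continuous_onI linear_continuous_on) (simp add: linear_conv_bounded_linear)
    have "norm (T x) = norm x" for x
    proof -
      have "(\<Sum>l\<in>UNIV. (x $ Transposition.transpose i k l)\<^sup>2) = (\<Sum>l\<in>UNIV. (x $ l)\<^sup>2)"
        by (rule sum.reindex_bij_betw) simp
      then show ?thesis by (simp add: T_def norm_vec_def L2_set_def)
    qed
    moreover have "T x $ i = x $ k" for x by (simp add: T_def)
    moreover have "(\<integral>x. (x $ i)\<^sup>2 * G (ln (norm x)) \<partial>distr lborel borel T)
        = (\<integral>x. (T x $ i)\<^sup>2 * G (ln (norm (T x))) \<partial>lborel)"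
      by (rule integral_distr) measurable
    moreover have "distr lborel borel T = lborel"
      using lborel_permute_coordinates[of i k] unfolding T_def[abs_def] .
    ultimately show ?thesis by simp
  qed
  have "CARD('n) * (\<integral>x. ((x::real^'n) $ i)\<^sup>2 * G (ln (norm x)) \<partial>lborel)
      = (\<Sum>k\<in>UNIV. \<integral>x. ((x::real^'n) $ k)\<^sup>2 * G (ln (norm x)) \<partial>lborel)"
    by (subst sum.cong[OF refl swap]) simp
  also have "\<dots> = (\<integral>x. (\<Sum>k\<in>UNIV. ((x::real^'n) $ k)\<^sup>2 * G (ln (norm x))) \<partial>lborel)"
    using integr by (intro Bochner_Integration.integral_sum[symmetric]) auto
  also have "\<dots> = (\<integral>x. (norm (x::real^'n))\<^sup>2 * G (ln (norm x)) \<partial>lborel)"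
    by (simp add: norm_vec_def L2_set_def sum_nonneg sum_distrib_right)
  also have "\<dots> = CARD('n) * unit_ball_vol CARD('n) * ?I"
    using norm by (simp add: has_bochner_integral_iff)
  finally show ?thesis
    using integr[of i] by (simp add: has_bochner_integral_iff)
qed

text \<open>The energy density of the test field has exactly this form. Borel measurability is
  recorded because the energy is an integral over \<open>lebesgue\<close>, and it allows passing to
  \<open>lborel\<close>.\<close>

lemma integral_annulus_log_radial:
  fixes \<alpha> \<beta> :: "real \<Rightarrow> real" and i :: "'n::finite"
  assumes \<alpha>: "continuous_on {A..B} \<alpha>" and \<beta>: "continuous_on {A..B} \<beta>"
  defines "F \<equiv> \<lambda>x::real^'n. indicator {A..B} (ln (norm x)) *
    (\<alpha> (ln (norm x)) + (x $ i)\<^sup>2 * \<beta> (ln (norm x)))"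
  shows "F \<in> borel_measurable borel"
    and "integral\<^sup>L lborel F = unit_ball_vol CARD('n) * integral {A..B}
      (\<lambda>t. CARD('n) * exp (CARD('n) * t) * \<alpha> t + exp ((real CARD('n) + 2) * t) * \<beta> t)"
proof -
  let ?n = "real CARD('n)"
  define \<alpha>' where "\<alpha>' t = indicator {A..B} t * \<alpha> t" for t
  define \<beta>' where "\<beta>' t = indicator {A..B} t * \<beta> t" for t
  have m[measurable]: "\<alpha>' \<in> borel_measurable borel" "\<beta>' \<in> borel_measurable borel"
    unfolding \<alpha>'_def[abs_def] \<beta>'_def[abs_def]
    using borel_measurable_continuous_on_indicator[OF _ \<alpha>] borel_measurable_continuous_on_indicator[OF _ \<beta>]
    by simp_all
  have F: "F = (\<lambda>x. \<alpha>' (ln (norm x)) + (x $ i)\<^sup>2 * \<beta>' (ln (norm x)))"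
    by (simp add: F_def \<alpha>'_def \<beta>'_def fun_eq_iff algebra_simps)
  show "F \<in> borel_measurable borel" unfolding F by measurable
  have set: "set_integrable lborel {A..B} u" "(LINT t:{A..B}|lborel. u t) = integral {A..B} u"
    if "continuous_on {A..B} u" for u :: "real \<Rightarrow> real"
    using borel_integrable_atLeastAtMost'[OF that] set_borel_integral_eq_integral(2)[of "{A..B}" u]
    by auto
  have c: "continuous_on {A..B} (\<lambda>t. exp (?n * t) * \<alpha> t)"
    "continuous_on {A..B} (\<lambda>t. exp ((?n + 2) * t) * \<beta> t)"
    by (intro continuous_intros \<alpha> \<beta>)+
  have 1: "has_bochner_integral lborel (\<lambda>t. exp (?n * t) * \<alpha>' t)
      (integral {A..B} (\<lambda>t. exp (?n * t) * \<alpha> t))"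
    using set[OF c(1)] unfolding set_integrable_def set_lebesgue_integral_def \<alpha>'_def
    by (simp add: has_bochner_integral_iff mult.left_commute)
  have 2: "has_bochner_integral lborel (\<lambda>t. exp ((?n + 2) * t) * \<beta>' t)
      (integral {A..B} (\<lambda>t. exp ((?n + 2) * t) * \<beta> t))"
    using set[OF c(2)] unfolding set_integrable_def set_lebesgue_integral_def \<beta>'_def
    by (simp add: has_bochner_integral_iff mult.left_commute)
  have dim: "DIM(real^'n) = CARD('n)" by simp
  have "has_bochner_integral lborel (\<lambda>x::real^'n. \<alpha>' (ln (norm x)))
      (DIM(real^'n) * unit_ball_vol DIM(real^'n) * (\<integral>t. exp (DIM(real^'n) * t) * \<alpha>' t \<partial>lborel))"
    by (rule has_bochner_integral_log_radial[OF m(1)]) (use 1 in \<open>simp add: has_bochner_integral_iff\<close>)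
  then have I1: "has_bochner_integral lborel (\<lambda>x::real^'n. \<alpha>' (ln (norm x)))
      (?n * unit_ball_vol ?n * integral {A..B} (\<lambda>t. exp (?n * t) * \<alpha> t))"
    unfolding dim using 1 by (simp add: has_bochner_integral_iff)
  have "has_bochner_integral lborel (\<lambda>x::real^'n. (x $ i)\<^sup>2 * \<beta>' (ln (norm x)))
      (unit_ball_vol ?n * (\<integral>t. exp ((?n + 2) * t) * \<beta>' t \<partial>lborel))"
    by (rule has_bochner_integral_coordinate_log_radial[OF m(2)]) (use 2 in \<open>simp add: has_bochner_integral_iff\<close>)
  then have I2: "has_bochner_integral lborel (\<lambda>x::real^'n. (x $ i)\<^sup>2 * \<beta>' (ln (norm x)))
      (unit_ball_vol ?n * integral {A..B} (\<lambda>t. exp ((?n + 2) * t) * \<beta> t))"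
    using 2 by (simp add: has_bochner_integral_iff)
  have "integral {A..B} (\<lambda>t. ?n * exp (?n * t) * \<alpha> t + exp ((?n + 2) * t) * \<beta> t)
      = ?n * integral {A..B} (\<lambda>t. exp (?n * t) * \<alpha> t) + integral {A..B} (\<lambda>t. exp ((?n + 2) * t) * \<beta> t)"
    using c[THEN integrable_continuous_real]
    by (simp add: integral_add integrable_on_mult_right mult.assoc)
  then show "integral\<^sup>L lborel F = unit_ball_vol ?n * integral {A..B}
      (\<lambda>t. ?n * exp (?n * t) * \<alpha> t + exp ((?n + 2) * t) * \<beta> t)"
    using has_bochner_integral_integral_eq[OF has_bochner_integral_add[OF I1 I2]]
    unfolding F by (simp add: algebra_simps)
qed

section \<open>The potential and the profile\<close>

text \<open>Adding the tangent inequalities at \<open>s\<close> and \<open>t\<close> gives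
  monotonicity in the interior, where tangents are available; continuity of \<open>W'\<close>
  carries it to the endpoint \<open>b\<close>.\<close>

lemma convex_on_deriv_mono:
  fixes W W' :: "real \<Rightarrow> real"
  assumes conv: "convex_on {..b} W"
    and d: "\<And>t. t \<le> b \<Longrightarrow> (W has_real_derivative W' t) (at t within {..b})"
    and cont: "continuous_on {..b} W'"
    and st: "s \<le> t" "t \<le> b"
  shows "W' s \<le> W' t"
proof -
  have *: "W' s \<le> W' t" if "s < t" "t < b" for s t
  proof -
    have "W x - W y \<ge> W' y * (x - y)" if "y < b" "x \<le> b" for x y
      by (rule convex_on_imp_above_tangent[OF conv]) (use that d in \<open>auto simp: interior_real_atMost\<close>)
    from this[of s t] this[of t s] that have "W' s * (t - s) \<le> W' t * (t - s)"
      by (simp add: algebra_simps)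
    then show ?thesis using that by simp
  qed
  consider "s = t" | "s < t" "t < b" | "s < t" "t = b" using st by linarith
  then show ?thesis
  proof cases
    case 3
    have "(W' \<longlongrightarrow> W' b) (at b within {..b})"
      using cont by (simp add: continuous_on)
    then have lim: "(W' \<longlongrightarrow> W' b) (at_left b)"
      by (rule tendsto_within_subset) auto
    have "eventually (\<lambda>x. x \<in> {s<..<b}) (at_left b)"
      using 3 by (intro eventually_at_left_real) auto
    then have "eventually (\<lambda>x. W' s \<le> W' x) (at_left b)"
      by eventually_elim (use * in auto)
    with lim 3 show ?thesis
      by (intro tendsto_lowerbound[of W' "W' t"]) auto
  qed (use * in auto)
qed

text \<open>\<open>W'\<close> vanishes at 0, an interior minimum of \<open>W\<close>. Let
  \<open>T\<close> be the largest point of \<open>{0..1}\<close> with \<open>W' \<le> 0\<close>. If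
  \<open>T\<close> were 1, monotonicity would force \<open>W' = 0\<close> on \<open>{0..1}\<close>,
  hence \<open>W = 0\<close> there.\<close>

lemma potential_threshold:
  fixes W W' :: "real \<Rightarrow> real"
  assumes d: "\<And>t. t \<le> 1 \<Longrightarrow> (W has_real_derivative W' t) (at t within {..1})"
    and cont: "continuous_on {..1} W'"
    and nonneg: "\<And>t. t \<le> 1 \<Longrightarrow> 0 \<le> W t"
    and conv: "convex_on {..1} W"
    and W0: "W 0 = 0"
    and nontriv: "\<exists>t\<in>{0..1}. W t \<noteq> 0"
  obtains c where "0 < c" "c \<le> 1"
    "\<And>s t. s \<le> t \<Longrightarrow> t \<le> 1 \<Longrightarrow> W' s \<le> W' t"
    "\<And>t. t \<le> 1 - c\<^sup>2 \<Longrightarrow> W' t \<le> 0"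
    "\<And>t. 1 - c\<^sup>2 < t \<Longrightarrow> t \<le> 1 \<Longrightarrow> 0 < W' t"
    "W' (1 - c\<^sup>2) = 0"
proof -
  have mono: "W' s \<le> W' t" if "s \<le> t" "t \<le> 1" for s t
    using convex_on_deriv_mono[OF conv _ cont that] d by blast
  have "(W has_real_derivative W' 0) (at 0)"
  proof -
    have "at (0::real) within {..1} = at 0"
      by (rule at_within_interior) (simp add: interior_real_atMost)
    then show ?thesis using d[of 0] by simp
  qed
  then have W'0: "W' 0 = 0"
    by (rule DERIV_local_min[where d = 1]) (use nonneg W0 in auto)
  define S where "S = {t\<in>{0..1}. W' t \<in> {..0}}"
  have "compact S" unfolding S_def
  proof -
    have "closed ({0..1} \<inter> W' -` {..0})"
      by (rule continuous_closed_preimage) (use continuous_on_subset[OF cont] in auto)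
    then have "compact ({0..1} \<inter> ({0..1} \<inter> W' -` {..0}))"
      by (intro compact_Int_closed) auto
    also have "{0..1} \<inter> ({0..1} \<inter> W' -` {..0}) = {t\<in>{0..1}. W' t \<in> {..0}}" by auto
    finally show "compact {t\<in>{0..1}. W' t \<in> {..0}}" .
  qed
  moreover have "0 \<in> S" by (simp add: S_def W'0)
  ultimately obtain T where T: "T \<in> S" "\<And>t. t \<in> S \<Longrightarrow> t \<le> T"
    using compact_attains_sup[of S] by blast
  have pos: "0 < W' t" if "T < t" "t \<le> 1" for t
  proof -
    have "t \<notin> S" using T(2)[of t] that(1) by auto
    then show ?thesis using T(1) that by (simp add: S_def)
  qed
  have zero: "W' T = 0"
    using T mono[of 0 T] W'0 by (auto simp: S_def)
  have "T \<noteq> 1"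
  proof
    assume "T = 1"
    then have z: "W' t = 0" if "0 \<le> t" "t \<le> 1" for t
      using mono[of 0 t] mono[of t 1] W'0 zero that by auto
    have "(W has_real_derivative 0) (at t within {0..1})" if "t \<in> {0..1}" for t
      using has_field_derivative_subset[OF d[of t], of "{0..1}"] z[of t] that by auto
    then have "\<exists>C. \<forall>t\<in>{0..1}. W t = C"
      by (intro has_field_derivative_zero_constant) auto
    then obtain C where C: "\<forall>t\<in>{0..1}. W t = C" by blast
    have "W t = 0" if "t \<in> {0..1}" for t
      using bspec[OF C that] bspec[OF C, of 0] W0 by simp
    with nontriv show False by blast
  qed
  with T have T01: "0 \<le> T" "T < 1" by (auto simp: S_def)
  show thesis
  \<comment> \<open>The modulus for which \<open>1 - c^2 = T\<close>.\<close>
  proof (rule that[of "sqrt (1 - T)"])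
    show "W' t \<le> 0" if "t \<le> 1 - (sqrt (1 - T))\<^sup>2" for t
      using mono[of t T] that T01 zero by auto
    show "W' s \<le> W' t" if "s \<le> t" "t \<le> 1" for s t
      using mono that .
    show "0 < W' t" if "1 - (sqrt (1 - T))\<^sup>2 < t" "t \<le> 1" for t
      using pos[of t] that T01 by simp
  qed (use T01 zero in auto)
qed

text \<open>Where \<open>u\<close> exceeds \<open>c\<close>, \<open>u' + m u / r\<close> is nondecreasing, so that \<open>u\<close> cannot return to \<open>c\<close>
  and grows at least linearly up to \<open>r = 1\<close>.\<close>

lemma profile_upper_bound:
  fixes u u' u'' :: "real \<Rightarrow> real" and m :: nat
  assumes m: "m \<in> {1, 2}"
    and cont: "continuous_on {0..1} u" and u0: "u 0 = 0"
    and d1: "\<And>r. 0 < r \<Longrightarrow> r < 1 \<Longrightarrow> (u has_real_derivative u' r) (at r)"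
    and d2: "\<And>r. 0 < r \<Longrightarrow> r < 1 \<Longrightarrow> (u' has_real_derivative u'' r) (at r)"
    and sub: "\<And>r. 0 < r \<Longrightarrow> r < 1 \<Longrightarrow> c \<le> u r \<Longrightarrow> 0 \<le> u'' r + m / r * u' r - m / r\<^sup>2 * u r"
    and c: "0 < c" and r: "0 < r" "r < 1" "c < u r"
  shows "c < 2 * r * u 1"
proof -
  have cpt: "compact {x\<in>{a..b}. u x \<le> c}" if "0 \<le> a" "b \<le> 1" for a b
  proof -
    have "closed ({a..b} \<inter> u -` {..c})"
      by (rule continuous_closed_preimage) (use that in \<open>auto intro: continuous_on_subset[OF cont]\<close>)
    then have "compact ({a..b} \<inter> ({a..b} \<inter> u -` {..c}))"
      by (intro compact_Int_closed) auto
    also have "{a..b} \<inter> ({a..b} \<inter> u -` {..c}) = {x\<in>{a..b}. u x \<le> c}" by auto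
    finally show ?thesis .
  qed
  have "0 \<in> {x\<in>{0..r}. u x \<le> c}" using r c u0 by auto
  \<comment> \<open>\<open>\<alpha>\<close> is the left end of the interval around \<open>r\<close>
    on which \<open>u > c\<close>. Continuity will give \<open>u \<alpha> = c\<close>, and then
    \<open>u 0 = 0\<close> forces \<open>\<alpha> > 0\<close>.\<close>
  then obtain \<alpha> where "\<alpha> \<in> {x\<in>{0..r}. u x \<le> c}" "\<forall>x\<in>{x\<in>{0..r}. u x \<le> c}. x \<le> \<alpha>"
    using compact_attains_sup[OF cpt[OF order_refl less_imp_le[OF r(2)]]] by blast
  then have \<alpha>: "0 \<le> \<alpha>" "\<alpha> \<le> r" "u \<alpha> \<le> c" "\<And>x. x \<in> {0..r} \<Longrightarrow> u x \<le> c \<Longrightarrow> x \<le> \<alpha>"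
    by auto
  have "\<alpha> < r" using \<alpha> r by (cases "\<alpha> = r") auto
  have u\<alpha>: "u \<alpha> = c"
  proof (rule ccontr)
    assume "u \<alpha> \<noteq> c"
    then have "u \<alpha> < c" using \<alpha> by simp
    moreover have "continuous_on {\<alpha>..r} u"
      by (rule continuous_on_subset[OF cont]) (use \<alpha> r in auto)
    ultimately obtain x where "\<alpha> \<le> x" "x \<le> r" "u x = c"
      using IVT'[of u \<alpha> c r] \<alpha> r by auto
    moreover from this have "x \<le> \<alpha>" using \<alpha>(1) by (intro \<alpha>(4)) auto
    ultimately show False using \<open>u \<alpha> < c\<close> by (metis antisym less_irrefl)
  qed
  then have "0 < \<alpha>" using \<alpha> u0 c by (cases "\<alpha> = 0") auto
  \<comment> \<open>The right end of that interval: the first return to values at most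
    \<open>c\<close>, or 1 if there is none.\<close>
  have "\<exists>\<beta>>r. \<beta> \<le> 1 \<and> (\<forall>x\<in>{r..<\<beta>}. c < u x) \<and> (u \<beta> \<le> c \<or> \<beta> = 1)"
  proof (cases "\<exists>x\<in>{r..1}. u x \<le> c")
    case True
    then have "{x\<in>{r..1}. u x \<le> c} \<noteq> {}" by blast
    then obtain \<beta> where "\<beta> \<in> {x\<in>{r..1}. u x \<le> c}" "\<forall>x\<in>{x\<in>{r..1}. u x \<le> c}. \<beta> \<le> x"
      using compact_attains_inf[OF cpt[OF less_imp_le[OF r(1)] order_refl]] by blast
    then have \<beta>: "r \<le> \<beta>" "\<beta> \<le> 1" "u \<beta> \<le> c" "\<And>x. x \<in> {r..1} \<Longrightarrow> u x \<le> c \<Longrightarrow> \<beta> \<le> x"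
      by auto
    moreover have "r \<noteq> \<beta>" using \<beta>(3) r by auto
    moreover have "c < u x" if "x \<in> {r..<\<beta>}" for x
      using \<beta>(4)[of x] \<beta>(2) that by (intro not_le_imp_less notI) auto
    ultimately show ?thesis by (intro exI[of _ \<beta>]) auto
  next
    case False
    then show ?thesis using r by (intro exI[of _ 1]) force
  qed
  then obtain \<beta> where \<beta>: "r < \<beta>" "\<beta> \<le> 1" "\<And>x. x \<in> {r..<\<beta>} \<Longrightarrow> c < u x" "u \<beta> \<le> c \<or> \<beta> = 1"
    by blast
  have above: "c < u x" if "\<alpha> < x" "x < \<beta>" for x
    using that \<alpha>(4)[of x] \<beta>(3)[of x] \<open>0 < \<alpha>\<close> by (cases "x \<le> r") force+
  \<comment> \<open>\<open>Y\<close> is \<open>x^-m\<close> times the derivative of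
    \<open>x^m u\<close>, and its own derivative is the expression that \<open>sub\<close> makes
    nonnegative.\<close>
  define Y where "Y x = u' x + m * (u x / x)" for x
  \<comment> \<open>A negative derivative would push \<open>u\<close> below \<open>c\<close>
    immediately to the right of \<open>\<alpha>\<close>.\<close>
  have "0 \<le> u' \<alpha>"
  proof (rule ccontr)
    assume "\<not> 0 \<le> u' \<alpha>"
    then obtain e where "0 < e" and e: "\<And>h. 0 < h \<Longrightarrow> h < e \<Longrightarrow> u (\<alpha> + h) < u \<alpha>"
      using DERIV_neg_dec_right[OF d1[of \<alpha>]] \<open>0 < \<alpha>\<close> \<open>\<alpha> < r\<close> r by force
    define h where "h = min e (\<beta> - \<alpha>) / 2"
    have "0 < h" "h < e" "\<alpha> + h < \<beta>"
      using \<open>0 < e\<close> \<open>\<alpha> < r\<close> \<beta>(1) by (auto simp: h_def min_def field_simps)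
    then show False
      using e[of h] above[of "\<alpha> + h"] u\<alpha> by auto
  qed
  then have Y\<alpha>: "m * c / \<alpha> \<le> Y \<alpha>" by (simp add: Y_def u\<alpha>)
  have Y: "m * c / \<alpha> \<le> Y x" if "\<alpha> < x" "x < \<beta>" for x
  proof -
    have "Y \<alpha> \<le> Y x"
    proof (rule DERIV_nonneg_imp_nondecreasing[where f = Y])
      fix y assume y: "\<alpha> \<le> y" "y \<le> x"
      then have y01: "0 < y" "y < 1" using \<open>0 < \<alpha>\<close> that \<beta> by auto
      have "(Y has_real_derivative u'' y + m / y * u' y - m / y\<^sup>2 * u y) (at y)"
        unfolding Y_def
        by (rule DERIV_cong[OF DERIV_add[OF d2 DERIV_cmult[OF DERIV_divide[OF d1 DERIV_ident]]]])
          (use y01 in \<open>auto simp: field_simps power2_eq_square\<close>)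
      moreover have "c \<le> u y" using above[of y] y that u\<alpha> by (cases "y = \<alpha>") auto
      ultimately show "\<exists>d. (Y has_real_derivative d) (at y) \<and> 0 \<le> d"
        using sub y01 by blast
    qed (use that in simp)
    with Y\<alpha> show ?thesis by simp
  qed
  \<comment> \<open>The derivative of \<open>x^m u\<close> is \<open>x^m Y\<close>, at least
    \<open>m c x^m / \<alpha>\<close>; \<open>Z\<close> is \<open>x^m u\<close> minus a primitive of
    this lower bound, so it cannot decrease.\<close>
  define Z where "Z x = x ^ m * u x - m * c / ((m + 1) * \<alpha>) * x ^ (m + 1)" for x
  have "Z \<alpha> \<le> Z \<beta>"
  proof -
    have Z: "(Z has_real_derivative x ^ m * (Y x - m * c / \<alpha>)) (at x)" if "\<alpha> < x" "x < \<beta>" for x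
    proof -
      have x: "0 < x" "x < 1" using \<open>0 < \<alpha>\<close> that \<beta> by auto
      show ?thesis unfolding Z_def Y_def
        by (rule DERIV_cong[OF DERIV_diff[OF DERIV_mult[OF DERIV_pow d1] DERIV_cmult[OF DERIV_pow]]])
          (use m x \<open>0 < \<alpha>\<close> in \<open>auto simp: field_simps power2_eq_square power3_eq_cube\<close>)
    qed
    have cZ: "continuous_on {\<alpha>..\<beta>} Z" unfolding Z_def
      by (intro continuous_intros continuous_on_subset[OF cont]) (use \<alpha> \<beta> in auto)
    have dZ: "Z differentiable (at x)" if "\<alpha> < x" "x < \<beta>" for x
      using Z[OF that] by (auto simp: real_differentiable_def)
    have "\<alpha> < \<beta>" using \<open>\<alpha> < r\<close> \<beta>(1) by simp
    from MVT[OF this cZ dZ]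
    obtain l z where z: "\<alpha> < z" "z < \<beta>" "(Z has_real_derivative l) (at z)" "Z \<beta> - Z \<alpha> = (\<beta> - \<alpha>) * l"
      by blast
    have "l = z ^ m * (Y z - m * c / \<alpha>)"
      using DERIV_unique[OF z(3) Z] z by blast
    then have "0 \<le> l" using Y[of z] z \<open>0 < \<alpha>\<close> by simp
    then have "0 \<le> (\<beta> - \<alpha>) * l" using z by simp
    with z(4) show ?thesis by simp
  qed
  then have mono: "(m + 1) * \<alpha> * Z \<alpha> \<le> (m + 1) * \<alpha> * Z \<beta>"
    using \<open>0 < \<alpha>\<close> by (intro mult_left_mono) auto
  have KZ: "(m + 1) * \<alpha> * Z x = (m + 1) * \<alpha> * x ^ m * u x - m * c * x ^ (m + 1)" for x
  proof -
    have "K * (p - q / K * y) = K * p - q * y" if "K \<noteq> 0" for K p q y :: real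
      using that by (simp add: right_diff_distrib)
    from this[of "(m + 1) * \<alpha>" "x ^ m * u x" "m * c" "x ^ (m + 1)"] \<open>0 < \<alpha>\<close>
    show ?thesis unfolding Z_def by (simp add: mult_ac)
  qed
  have key: "c * \<alpha> ^ (m + 1) \<le> (m + 1) * \<alpha> * \<beta> ^ m * u \<beta> - m * c * \<beta> ^ (m + 1)"
    using mono KZ[of \<alpha>] KZ[of \<beta>] by (simp add: u\<alpha> algebra_simps)
  \<comment> \<open>A return to \<open>c\<close> would contradict the strict weighted mean
    inequality for \<open>\<alpha> < \<beta>\<close>, whose gap is
    \<open>(\<beta> - \<alpha>)^2\<close> for \<open>m = 1\<close> and
    \<open>(\<beta> - \<alpha>)^2 (2 \<beta> + \<alpha>)\<close> for \<open>m = 2\<close>.\<close>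
  have "\<not> u \<beta> \<le> c"
  proof
    assume "u \<beta> \<le> c"
    then have "(m + 1) * \<alpha> * \<beta> ^ m * u \<beta> \<le> (m + 1) * \<alpha> * \<beta> ^ m * c"
      using \<open>0 < \<alpha>\<close> \<open>\<alpha> < r\<close> \<beta>(1) by (intro mult_left_mono) auto
    with key have "c * \<alpha> ^ (m + 1) \<le> c * ((m + 1) * \<alpha> * \<beta> ^ m - m * \<beta> ^ (m + 1))"
      by (simp add: algebra_simps)
    then have k: "\<alpha> ^ (m + 1) \<le> (m + 1) * \<alpha> * \<beta> ^ m - m * \<beta> ^ (m + 1)"
      using c by simp
    have ab: "0 < (\<beta> - \<alpha>)\<^sup>2" using \<open>\<alpha> < r\<close> \<beta>(1) by simp
    then have ab': "0 < (\<beta> - \<alpha>)\<^sup>2 * (2 * \<beta> + \<alpha>)" using \<open>0 < \<alpha>\<close> \<open>\<alpha> < r\<close> \<beta>(1) by simp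
    consider "m = 1" | "m = 2" using m by auto
    then show False
    proof cases
      case 1
      then show False using ab k by (simp add: power2_eq_square algebra_simps)
    next
      case 2
      then show False using ab' k by (simp add: power2_eq_square power3_eq_cube algebra_simps)
    qed
  qed
  with \<beta> have "\<beta> = 1" by blast
  have "0 < c * \<alpha> ^ (m + 1)" using c \<open>0 < \<alpha>\<close> by simp
  then have k: "m * c < (m + 1) * \<alpha> * u 1" using key \<open>\<beta> = 1\<close> by simp
  then have "0 < (m + 1) * \<alpha> * u 1" using c by (smt (verit) mult_nonneg_nonneg of_nat_0_le_iff)
  then have "0 < u 1" by (rule zero_less_mult_pos) (use \<open>0 < \<alpha>\<close> in simp)
  then have au: "\<alpha> * u 1 < r * u 1" "0 < \<alpha> * u 1" using \<open>\<alpha> < r\<close> \<open>0 < \<alpha>\<close> by simp_all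
  have kk: "m * c < (m + 1) * (\<alpha> * u 1)" using k by (simp add: mult.assoc)
  \<comment> \<open>The factor 2 bounds \<open>(m + 1) / m\<close>.\<close>
  have "c < 2 * y" if "x < y" "0 < x" "m * c < (m + 1) * x" for x y :: real
    using m that by auto
  from this[OF au kk] show ?thesis by simp
qed

section \<open>The energy in the logarithmic variable\<close>

text \<open>Test the equation for \<open>g\<close> with \<open>g h\<^sup>2\<close>: the gradient terms complete to the square
  \<open>(g h)'\<^sup>2\<close>, which is discarded.\<close>

lemma stability_inequality:
  fixes g g' g'' h h' Q :: "real \<Rightarrow> real" and m :: real
  assumes AB: "A \<le> B"
    and g: "\<And>t. t \<in> {A..B} \<Longrightarrow> (g has_real_derivative g' t) (at t)"
    and g': "\<And>t. t \<in> {A..B} \<Longrightarrow> (g' has_real_derivative g'' t) (at t)"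
    and eq: "\<And>t. t \<in> {A..B} \<Longrightarrow> g'' t + (m - 1) * g' t - m * g t + Q t * g t = 0"
    and h: "\<And>t. (h has_real_derivative h' t) (at t)" "h A = 0" "h B = 0"
    and cont: "continuous_on {A..B} Q" "continuous_on {A..B} h'"
  shows "integral {A..B} (\<lambda>t. (g t)\<^sup>2 * (m * (h t)\<^sup>2 + (m - 1) * (h t * h' t) - (h' t)\<^sup>2))
    \<le> integral {A..B} (\<lambda>t. Q t * (g t)\<^sup>2 * (h t)\<^sup>2)"
proof -
  \<comment> \<open>\<open>\<Psi>\<close> is the boundary term of the integration by parts: its
    first summand handles \<open>g g'' h^2\<close>, its second \<open>(m - 1) g g' h^2\<close>. It
    vanishes at both ends together with \<open>h\<close>.\<close>
  define \<Psi>' where "\<Psi>' t = (g' t * h t + g t * h' t)\<^sup>2 - (Q t * (g t)\<^sup>2 * (h t)\<^sup>2 -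
    (g t)\<^sup>2 * (m * (h t)\<^sup>2 + (m - 1) * (h t * h' t) - (h' t)\<^sup>2))" for t
  define \<Psi> where "\<Psi> t = g t * g' t * (h t)\<^sup>2 + (m - 1) / 2 * ((g t)\<^sup>2 * (h t)\<^sup>2)" for t
  have c: "continuous_on {A..B} g" "continuous_on {A..B} h"
    by (rule DERIV_continuous_on, erule has_field_derivative_at_within[OF g])
      (rule DERIV_continuous_on, rule has_field_derivative_at_within[OF h(1)])
  have i: "(\<lambda>t. (g t)\<^sup>2 * (m * (h t)\<^sup>2 + (m - 1) * (h t * h' t) - (h' t)\<^sup>2)) integrable_on {A..B}"
    "(\<lambda>t. Q t * (g t)\<^sup>2 * (h t)\<^sup>2) integrable_on {A..B}"
    by (intro integrable_continuous_real continuous_intros c cont)+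
  have "(\<Psi>' has_integral (\<Psi> B - \<Psi> A)) {A..B}"
  proof (rule fundamental_theorem_of_calculus[OF AB])
    fix t assume t: "t \<in> {A..B}"
    have "((\<lambda>t. g t * g' t * (h t)\<^sup>2 + K * ((g t)\<^sup>2 * (h t)\<^sup>2)) has_real_derivative
        (g' t * g' t + g t * g'' t) * (h t)\<^sup>2 + g t * g' t * (2 * h t * h' t)
        + K * (2 * g t * g' t * (h t)\<^sup>2 + (g t)\<^sup>2 * (2 * h t * h' t))) (at t)" for K
      using g[OF t] g'[OF t] h(1)[of t]
      by (auto intro!: derivative_eq_intros simp: algebra_simps)
    then have "(\<Psi> has_real_derivative (g' t * g' t + g t * g'' t) * (h t)\<^sup>2 + g t * g' t * (2 * h t * h' t)
        + (m - 1) / 2 * (2 * g t * g' t * (h t)\<^sup>2 + (g t)\<^sup>2 * (2 * h t * h' t))) (at t)"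
      unfolding \<Psi>_def[abs_def] .
    moreover have "(g' t * g' t + g t * g'' t) * (h t)\<^sup>2 + g t * g' t * (2 * h t * h' t)
        + (m - 1) / 2 * (2 * g t * g' t * (h t)\<^sup>2 + (g t)\<^sup>2 * (2 * h t * h' t)) = \<Psi>' t"
    proof -
      have g'': "g'' t = m * g t - (m - 1) * g' t - Q t * g t" using eq[OF t] by simp
      show ?thesis unfolding \<Psi>'_def g'' by (simp add: power2_eq_square field_simps)
    qed
    ultimately show "(\<Psi> has_vector_derivative \<Psi>' t) (at t within {A..B})"
      by (simp add: has_real_derivative_iff_has_vector_derivative has_vector_derivative_at_within)
  qed
  then have "(\<Psi>' has_integral 0) {A..B}" by (simp add: \<Psi>_def h)
  from has_integral_add[OF this has_integral_diff[OF i(2)[THEN integrable_integral] i(1)[THEN integrable_integral]]]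
  have "0 \<le> 0 + (integral {A..B} (\<lambda>t. Q t * (g t)\<^sup>2 * (h t)\<^sup>2) -
      integral {A..B} (\<lambda>t. (g t)\<^sup>2 * (m * (h t)\<^sup>2 + (m - 1) * (h t * h' t) - (h' t)\<^sup>2)))"
    by (rule has_integral_nonneg) (simp add: \<Psi>'_def)
  then show ?thesis by simp
qed

text \<open>In \<open>stability_inequality\<close>, \<open>g^2\<close> is replaced by
  \<open>c^2\<close> on both sides. On the right this uses \<open>gc\<close>. On the left the
  shortfall is controlled by \<open>near\<close>: the part \<open>\<eta>\<close> costs a multiple of
  the integral of \<open>h^2\<close>, the part with \<open>\<sigma>\<close> a multiple of the
  right-hand side itself, which explains \<open>1 + m * \<sigma>\<close>.\<close>

lemma potential_lower_bound:
  fixes g g' g'' h h' Q :: "real \<Rightarrow> real" and m :: real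
  assumes AB: "A \<le> B"
    and g: "\<And>t. t \<in> {A..B} \<Longrightarrow> (g has_real_derivative g' t) (at t)"
    and g': "\<And>t. t \<in> {A..B} \<Longrightarrow> (g' has_real_derivative g'' t) (at t)"
    and eq: "\<And>t. t \<in> {A..B} \<Longrightarrow> g'' t + (m - 1) * g' t - m * g t + Q t * g t = 0"
    and h: "\<And>t. (h has_real_derivative h' t) (at t)" "h A = 0" "h B = 0"
    and cont: "continuous_on {A..B} Q" "continuous_on {A..B} h'"
    and m: "1 \<le> m" and c: "0 < c"
    and gc: "\<And>t. t \<in> {A..B} \<Longrightarrow> (g t)\<^sup>2 \<le> c\<^sup>2"
    and Q: "\<And>t. t \<in> {A..B} \<Longrightarrow> 0 \<le> Q t"
    and near: "\<And>t. t \<in> {A..B} \<Longrightarrow> c\<^sup>2 - (g t)\<^sup>2 \<le> \<eta> + c\<^sup>2 * \<sigma> * Q t"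
  shows "integral {A..B} (\<lambda>t. m * (h t)\<^sup>2 - (h' t)\<^sup>2 - (m - 1) * \<bar>h t * h' t\<bar>)
      - m * \<eta> / c\<^sup>2 * integral {A..B} (\<lambda>t. (h t)\<^sup>2)
    \<le> (1 + m * \<sigma>) * integral {A..B} (\<lambda>t. Q t * (h t)\<^sup>2)"
proof -
  have ct: "continuous_on {A..B} g" "continuous_on {A..B} h"
    by (rule DERIV_continuous_on, erule has_field_derivative_at_within[OF g])
      (rule DERIV_continuous_on, rule has_field_derivative_at_within[OF h(1)])
  let ?P = "\<lambda>t. m * (h t)\<^sup>2 - (h' t)\<^sup>2 - (m - 1) * \<bar>h t * h' t\<bar>"
  have i: "?P integrable_on {A..B}" "(\<lambda>t. (h t)\<^sup>2) integrable_on {A..B}"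
    "(\<lambda>t. Q t * (h t)\<^sup>2) integrable_on {A..B}"
    by (intro integrable_continuous_real continuous_intros ct cont)+
  have "c\<^sup>2 * integral {A..B} ?P - m * \<eta> * integral {A..B} (\<lambda>t. (h t)\<^sup>2)
      - m * c\<^sup>2 * \<sigma> * integral {A..B} (\<lambda>t. Q t * (h t)\<^sup>2)
    = integral {A..B} (\<lambda>t. c\<^sup>2 * ?P t - m * \<eta> * (h t)\<^sup>2 - m * c\<^sup>2 * \<sigma> * (Q t * (h t)\<^sup>2))"
    using i by (simp add: integral_diff integrable_diff integrable_on_mult_right)
  also have "\<dots> \<le> integral {A..B} (\<lambda>t. (g t)\<^sup>2 * (m * (h t)\<^sup>2 + (m - 1) * (h t * h' t) - (h' t)\<^sup>2))"
  proof (rule integral_le)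
    fix t assume t: "t \<in> {A..B}"
    have "m * (h t)\<^sup>2 * (c\<^sup>2 - (g t)\<^sup>2) \<le> m * (h t)\<^sup>2 * (\<eta> + c\<^sup>2 * \<sigma> * Q t)"
      using near[OF t] m by (intro mult_left_mono) auto
    moreover have "(g t)\<^sup>2 * (h' t)\<^sup>2 \<le> c\<^sup>2 * (h' t)\<^sup>2"
      using gc[OF t] by (intro mult_right_mono) auto
    moreover have "(g t)\<^sup>2 * ((m - 1) * - (h t * h' t)) \<le> c\<^sup>2 * ((m - 1) * \<bar>h t * h' t\<bar>)"
    proof -
      have "(g t)\<^sup>2 * ((m - 1) * - (h t * h' t)) \<le> (g t)\<^sup>2 * ((m - 1) * \<bar>h t * h' t\<bar>)"
        using m by (intro mult_left_mono) auto
      also have "\<dots> \<le> c\<^sup>2 * ((m - 1) * \<bar>h t * h' t\<bar>)"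
        using gc[OF t] m by (intro mult_right_mono) auto
      finally show ?thesis .
    qed
    ultimately show "c\<^sup>2 * ?P t - m * \<eta> * (h t)\<^sup>2 - m * c\<^sup>2 * \<sigma> * (Q t * (h t)\<^sup>2) \<le>
        (g t)\<^sup>2 * (m * (h t)\<^sup>2 + (m - 1) * (h t * h' t) - (h' t)\<^sup>2)"
      by (simp add: algebra_simps)
  qed (intro integrable_continuous_real continuous_intros ct cont)+
  also have "\<dots> \<le> integral {A..B} (\<lambda>t. Q t * (g t)\<^sup>2 * (h t)\<^sup>2)"
    by (rule stability_inequality[OF AB g g' eq h cont])
  also have "\<dots> \<le> integral {A..B} (\<lambda>t. c\<^sup>2 * (Q t * (h t)\<^sup>2))"
  proof (rule integral_le)
    fix t assume t: "t \<in> {A..B}"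
    have "(g t)\<^sup>2 * (Q t * (h t)\<^sup>2) \<le> c\<^sup>2 * (Q t * (h t)\<^sup>2)"
      using gc[OF t] Q[OF t] by (intro mult_right_mono) auto
    then show "Q t * (g t)\<^sup>2 * (h t)\<^sup>2 \<le> c\<^sup>2 * (Q t * (h t)\<^sup>2)" by (simp add: mult_ac)
  qed (intro integrable_continuous_real continuous_intros ct cont)+
  also have "\<dots> = c\<^sup>2 * integral {A..B} (\<lambda>t. Q t * (h t)\<^sup>2)" by simp
  finally have "c\<^sup>2 * integral {A..B} ?P - m * \<eta> * integral {A..B} (\<lambda>t. (h t)\<^sup>2)
      \<le> c\<^sup>2 * ((1 + m * \<sigma>) * integral {A..B} (\<lambda>t. Q t * (h t)\<^sup>2))"
    by (simp add: algebra_simps)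
  moreover have "c\<^sup>2 * integral {A..B} ?P - m * \<eta> * integral {A..B} (\<lambda>t. (h t)\<^sup>2)
      = c\<^sup>2 * (integral {A..B} ?P - m * \<eta> / c\<^sup>2 * integral {A..B} (\<lambda>t. (h t)\<^sup>2))"
    using c by (simp add: right_diff_distrib)
  ultimately show ?thesis using c by (simp only: mult_le_cancel_left_pos zero_less_power)
qed

lemma integral_rescale:
  fixes F :: "real \<Rightarrow> real"
  assumes L: "0 < L" and F: "continuous_on {0..1} F"
  shows "integral {B - L..B} (\<lambda>t. F ((t - (B - L)) / L)) = L * integral {0..1} F"
proof -
  have "((\<lambda>t. (1 / L) *\<^sub>R F ((t - (B - L)) / L)) has_integral
      integral {(B - L - (B - L)) / L..(B - (B - L)) / L} F) {B - L..B}"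
    by (rule has_integral_substitution[OF _ _ _ F])
      (use L in \<open>auto intro!: derivative_eq_intros simp: field_simps\<close>)
  from has_integral_mult_right[OF this, of L] L show ?thesis
    by (auto intro: integral_unique)
qed

text \<open>Stretching in the logarithmic variable makes the derivatives of the test profile
  negligible.\<close>

lemma slowly_varying_bump:
  obtains L H H' H'' where "0 < L" "H \<in> smooth_bump" "H' \<in> smooth_bump" "H'' \<in> smooth_bump"
    "\<And>s. (H has_real_derivative H' s) (at s)" "\<And>s. (H' has_real_derivative H'' s) (at s)"
    "integral {B - L..B} (\<lambda>t. K * ((H' ((t - (B - L)) / L) / L)\<^sup>2 + (H'' ((t - (B - L)) / L) / L\<^sup>2)\<^sup>2)
      - (H ((t - (B - L)) / L))\<^sup>2) < 0"
proof -
  define H where "H s = flat 1 s * flat 1 (1 - s)" for s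
  have H: "H \<in> smooth_bump" unfolding H_def by (rule smooth_bump.flat)
  obtain H' where H': "H' \<in> smooth_bump" "\<And>s. (H has_real_derivative H' s) (at s)"
    using smooth_bump_derivative[OF H] by metis
  obtain H'' where H'': "H'' \<in> smooth_bump" "\<And>s. (H' has_real_derivative H'' s) (at s)"
    using smooth_bump_derivative[OF H'(1)] by metis
  have cont: "continuous_on S u" if "u \<in> smooth_bump" for u S
  proof -
    obtain u' where "\<And>s. (u has_real_derivative u' s) (at s)"
      using smooth_bump_derivative[OF \<open>u \<in> smooth_bump\<close>] by metis
    then show ?thesis by (rule DERIV_continuous_on[OF has_field_derivative_at_within])
  qed
  note c = cont[OF H] cont[OF H'(1)] cont[OF H''(1)]
  define I0 where "I0 = integral {0..1} (\<lambda>s. (H s)\<^sup>2)"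
  define I1 where "I1 = integral {0..1} (\<lambda>s. (H' s)\<^sup>2)"
  define I2 where "I2 = integral {0..1} (\<lambda>s. (H'' s)\<^sup>2)"
  have "I0 \<noteq> 0"
  proof -
    have "H (1 / 2) \<noteq> 0" by (simp add: H_def flat_def)
    then show ?thesis unfolding I0_def
      by (subst integral_eq_0_iff) (auto intro!: continuous_intros c bexI[of _ "1 / 2"])
  qed
  moreover have I: "0 \<le> I0" "0 \<le> I1" "0 \<le> I2"
    unfolding I0_def I1_def I2_def
    by (auto intro!: integral_nonneg integrable_continuous_real continuous_intros c)
  ultimately have "0 < I0" by simp
  \<comment> \<open>For \<open>L \<ge> 1\<close> the derivative terms are at most
    \<open>\<bar>K\<bar> (I1 + I2) / L\<close>; this choice makes that less than \<open>I0\<close>,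
    and the summand 1 makes both \<open>L \<ge> 1\<close> and the inequality strict.\<close>
  define L where "L = 1 + \<bar>K\<bar> * (I1 + I2) / I0"
  have "0 \<le> \<bar>K\<bar> * (I1 + I2) / I0"
    by (intro divide_nonneg_nonneg mult_nonneg_nonneg add_nonneg_nonneg I abs_ge_zero)
  then have L: "1 \<le> L" by (simp add: L_def)
  have LI: "\<bar>K\<bar> * (I1 + I2) < L * I0"
    unfolding L_def using \<open>0 < I0\<close> by (simp add: distrib_right)
  let ?F = "\<lambda>s. K * ((H' s / L)\<^sup>2 + (H'' s / L\<^sup>2)\<^sup>2) - (H s)\<^sup>2"
  have "integral {0..1} ?F = K * (I1 / L\<^sup>2 + I2 / (L\<^sup>2)\<^sup>2) - I0"
  proof -
    have i: "(\<lambda>s. (H s)\<^sup>2) integrable_on {0..1}" "(\<lambda>s. (H' s)\<^sup>2) integrable_on {0..1}"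
      "(\<lambda>s. (H'' s)\<^sup>2) integrable_on {0..1}"
      by (intro integrable_continuous_real continuous_intros c)+
    have "(?F has_integral (K * (I1 / L\<^sup>2 + I2 / (L\<^sup>2)\<^sup>2) - I0)) {0..1}"
      unfolding power_divide I0_def I1_def I2_def
      by (intro has_integral_diff has_integral_mult_right has_integral_add has_integral_divide
          integrable_integral i)
    then show ?thesis by (rule integral_unique)
  qed
  also have "\<dots> \<le> \<bar>K\<bar> * (I1 / L + I2 / L) - I0"
  proof -
    have "L * 1 \<le> L * L" "1 * 1 \<le> L * L" using L by (intro mult_mono; simp)+
    then have L2: "L \<le> L\<^sup>2" "1 \<le> L\<^sup>2" by (simp_all add: power2_eq_square)
    then have "L * 1 \<le> L\<^sup>2 * L\<^sup>2" using L by (intro mult_mono) auto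
    then have "L \<le> (L\<^sup>2)\<^sup>2" by (simp add: power2_eq_square)
    with L2 have "I1 / L\<^sup>2 + I2 / (L\<^sup>2)\<^sup>2 \<le> I1 / L + I2 / L"
      using I L by (intro add_mono divide_left_mono) auto
    then have "\<bar>K\<bar> * (I1 / L\<^sup>2 + I2 / (L\<^sup>2)\<^sup>2) \<le> \<bar>K\<bar> * (I1 / L + I2 / L)"
      by (rule mult_left_mono) simp
    moreover have "K * (I1 / L\<^sup>2 + I2 / (L\<^sup>2)\<^sup>2) \<le> \<bar>K\<bar> * (I1 / L\<^sup>2 + I2 / (L\<^sup>2)\<^sup>2)"
      using I by (intro mult_right_mono) auto
    ultimately show ?thesis by (intro diff_right_mono) (rule order_trans)
  qed
  also have "\<dots> = (\<bar>K\<bar> * (I1 + I2) - L * I0) / L"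
    using L by (simp add: diff_divide_distrib add_divide_distrib distrib_left)
  also have "\<dots> < 0" using LI L by (intro divide_neg_pos) auto
  finally have neg: "integral {0..1} ?F < 0" .
  have "integral {B - L..B} (\<lambda>t. ?F ((t - (B - L)) / L)) = L * integral {0..1} ?F"
    using L by (intro integral_rescale[where F = ?F] continuous_intros c) auto
  also have "\<dots> < 0" using neg L by (simp add: mult_pos_neg)
  finally show thesis using L H H' H'' by (intro that[of L H H' H'']) auto
qed

text \<open>Here \<open>x\<close>, \<open>y\<close>, \<open>z\<close> stand for \<open>h\<close>,
  \<open>h'\<close>, \<open>h''\<close>. The left side is the Hessian density minus \<open>m\<close>
  times the density bounding the potential from below. Its coefficient of \<open>x^2\<close> is -1
  for \<open>m = 1\<close> and \<open>25/16 - 4\<close> for \<open>m = 2\<close>; the excess below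
  -1 in the second case absorbs the cross terms.\<close>

lemma energy_density_bound:
  fixes x y z a k l :: real and m :: nat
  assumes m: "m \<in> {1, 2}"
  defines "a \<equiv> (real m - 1) / 2"
  defines "k \<equiv> y - a * x"
  defines "l \<equiv> z - (2 * a + 2) * y + a * (a + 2) * x"
  shows "(3 * m + 9) * k\<^sup>2 + 6 * k * l + l\<^sup>2 - m * (m * x\<^sup>2 - y\<^sup>2 - (real m - 1) * \<bar>x * y\<bar>)
    \<le> 24 * (y\<^sup>2 + z\<^sup>2) - x\<^sup>2"
proof -
  consider "m = 1" | "m = 2" using m by auto
  then show ?thesis
  proof cases
    case 1
    have "0 \<le> (y - z)\<^sup>2" by simp
    then have "2 * (y * z) \<le> y\<^sup>2 + z\<^sup>2" by (simp add: power2_diff mult.assoc)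
    moreover have "0 \<le> y\<^sup>2" "0 \<le> z\<^sup>2" by auto
    moreover have S: "(3 * m + 9) * k\<^sup>2 + 6 * k * l + l\<^sup>2 = 4 * y\<^sup>2 + 2 * (y * z) + z\<^sup>2"
      unfolding k_def l_def a_def 1 by (simp add: power2_eq_square algebra_simps)
    moreover have P: "m * (m * x\<^sup>2 - y\<^sup>2 - (real m - 1) * \<bar>x * y\<bar>) = x\<^sup>2 - y\<^sup>2"
      unfolding 1 by simp
    moreover have "4 * b + 2 * w + d - (e - b) \<le> 24 * (b + d) - e"
      if "2 * w \<le> b + d" "0 \<le> b" "0 \<le> d" for b d e w :: real
      using that by simp
    ultimately show ?thesis unfolding S P by blast
  next
    case 2
    \<comment> \<open>The weights leave \<open>25/16 + 1 + 1/4 - 4 < -1\<close> in front of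
      \<open>x^2\<close> and give \<open>6 + 2 + 16 = 24\<close> in front of \<open>y^2\<close>, the
      source of the constant 24.\<close>
    have "0 \<le> (\<bar>x\<bar> - 4 * \<bar>y\<bar>)\<^sup>2" "0 \<le> (x + z)\<^sup>2" "0 \<le> x\<^sup>2" "0 \<le> z\<^sup>2" by auto
    then have "8 * \<bar>x * y\<bar> \<le> x\<^sup>2 + 16 * y\<^sup>2" "- 2 * (x * z) \<le> x\<^sup>2 + z\<^sup>2" "0 \<le> x\<^sup>2" "0 \<le> z\<^sup>2"
      by (auto simp: power2_diff power2_sum abs_mult)
    moreover have "- (x * y) \<le> \<bar>x * y\<bar>" by simp
    moreover have S: "(3 * m + 9) * k\<^sup>2 + 6 * k * l + l\<^sup>2 =
        25 / 16 * x\<^sup>2 - 6 * (x * y) - 1 / 2 * (x * z) + 6 * y\<^sup>2 + z\<^sup>2"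
      unfolding k_def l_def a_def 2 by (simp add: power2_eq_square algebra_simps)
    moreover have P: "m * (m * x\<^sup>2 - y\<^sup>2 - (real m - 1) * \<bar>x * y\<bar>) = 4 * x\<^sup>2 - 2 * y\<^sup>2 - 2 * \<bar>x * y\<bar>"
      unfolding 2 by simp
    moreover have "25 / 16 * b - 6 * p - 1 / 2 * q + 6 * d + e - (4 * b - 2 * d - 2 * w) \<le> 24 * (d + e) - b"
      if "8 * w \<le> b + 16 * d" "- 2 * q \<le> b + e" "0 \<le> b" "0 \<le> e" "- p \<le> w" for b d e p q w :: real
      using that by simp
    ultimately show ?thesis unfolding S P by blast
  qed
qed

text \<open>Where \<open>\<bar>f\<bar> \<ge> c\<close> the nonlinearity has the sign required by
  \<open>profile_upper_bound\<close>, for \<open>f\<close> and for \<open>- f\<close>. With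
  \<open>f 1 = 1\<close>, an excess would give \<open>c < 2 * r\<close> or
  \<open>c < - 2 * r\<close>, both impossible for \<open>0 < r \<le> c / 2\<close>.\<close>

lemma profile_square_le:
  assumes m: "m \<in> {1, 2}" and prof: "vortex_profile (Suc m) W' \<epsilon> f"
    and c: "0 < c" and W': "\<And>t. t \<le> 1 - c\<^sup>2 \<Longrightarrow> W' t \<le> 0"
    and r: "0 < r" "r \<le> c / 2" "r < 1"
  shows "(f r)\<^sup>2 \<le> c\<^sup>2"
proof -
  obtain f' f'' where ode: "\<And>r. 0 < r \<Longrightarrow> r < 1 \<Longrightarrow> (f has_real_derivative f' r) (at r) \<and>
        (f' has_real_derivative f'' r) (at r) \<and>
        - f'' r - m / r * f' r + m / r\<^sup>2 * f r = 1 / \<epsilon>\<^sup>2 * (f r * W' (1 - (f r)\<^sup>2))"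
    using prof unfolding vortex_profile_def by (auto simp: Ball_def)
  have bd: "continuous_on {0..1} f" "f 0 = 0" "f 1 = 1"
    using prof unfolding vortex_profile_def by auto
  have W'f: "W' (1 - (f r)\<^sup>2) \<le> 0" if "c \<le> \<bar>f r\<bar>" for r
  proof -
    have "\<bar>c\<bar> \<le> \<bar>f r\<bar>" using that c by simp
    then have "c\<^sup>2 \<le> (f r)\<^sup>2" by (simp only: abs_le_square_iff)
    then show ?thesis by (intro W') simp
  qed
  have "\<not> c < f r"
  proof
    assume cf: "c < f r"
    have "c < 2 * r * f 1"
    proof (rule profile_upper_bound[OF m bd(1,2), of f' f''])
      fix r assume r: "0 < r" "r < 1" "c \<le> f r"
      have fW: "f r * W' (1 - (f r)\<^sup>2) \<le> 0"
        using W'f[of r] r c by (intro mult_nonneg_nonpos) auto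
      have "1 / \<epsilon>\<^sup>2 * (f r * W' (1 - (f r)\<^sup>2)) \<le> 0"
        by (rule mult_nonneg_nonpos[OF _ fW]) simp
      then show "0 \<le> f'' r + m / r * f' r - m / r\<^sup>2 * f r"
        using ode[of r] r by linarith
    qed (use ode c r cf in auto)
    with bd r show False by simp
  qed
  moreover have "\<not> c < - f r"
  proof
    assume cf: "c < - f r"
    have "c < 2 * r * (- f 1)"
    proof (rule profile_upper_bound[OF m, of "\<lambda>r. - f r" "\<lambda>r. - f' r" "\<lambda>r. - f'' r"])
      fix r assume r: "0 < r" "r < 1" "c \<le> - f r"
      have fW: "0 \<le> f r * W' (1 - (f r)\<^sup>2)"
        using W'f[of r] r c by (intro mult_nonpos_nonpos) auto
      have "0 \<le> 1 / \<epsilon>\<^sup>2 * (f r * W' (1 - (f r)\<^sup>2))"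
        by (rule mult_nonneg_nonneg[OF _ fW]) simp
      then show "0 \<le> - f'' r + m / r * - f' r - m / r\<^sup>2 * - f r"
        using ode[of r] r by simp
    qed (use ode c r cf bd in \<open>auto intro!: continuous_intros derivative_intros\<close>)
    with bd r c show False by simp
  qed
  ultimately have "\<bar>f r\<bar> \<le> \<bar>c\<bar>" using c by linarith
  then show ?thesis by (simp only: abs_le_square_iff)
qed

text \<open>The Hessian part is compared with \<open>potential_lower_bound\<close>. Without error
  terms the balance is strictly negative, so a fixed small \<open>\<eta>\<close> is affordable, and
  the remaining error, of order \<open>\<epsilon>^2\<close>, disappears in the limit.\<close>

lemma radial_energy_negative:
  fixes W' h h' h'' k l :: "real \<Rightarrow> real" and a L B c :: real and Q f :: "real \<Rightarrow> real \<Rightarrow> real" and m :: nat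
  assumes m: "m \<in> {1, 2}"
    and c: "0 < c" "c \<le> 1"
    and mono: "\<And>s t. s \<le> t \<Longrightarrow> t \<le> 1 \<Longrightarrow> W' s \<le> W' t"
    and W'neg: "\<And>t. t \<le> 1 - c\<^sup>2 \<Longrightarrow> W' t \<le> 0"
    and W'pos: "\<And>t. 1 - c\<^sup>2 < t \<Longrightarrow> t \<le> 1 \<Longrightarrow> 0 < W' t"
    and W'0: "W' (1 - c\<^sup>2) = 0"
    and W'cont: "continuous_on {..1} W'"
    and prof: "\<And>\<epsilon>. 0 < \<epsilon> \<Longrightarrow> vortex_profile (Suc m) W' \<epsilon> (f \<epsilon>)"
    and L: "0 < L" and B: "B = ln (c / 2)"
    and h: "\<And>t. (h has_real_derivative h' t) (at t)" "h (B - L) = 0" "h B = 0"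
    and h': "\<And>t. (h' has_real_derivative h'' t) (at t)" "continuous_on UNIV h''"
    and small: "integral {B - L..B} (\<lambda>t. 24 * ((h' t)\<^sup>2 + (h'' t)\<^sup>2) - (h t)\<^sup>2) < 0"
  defines "a \<equiv> (real m - 1) / 2"
  defines "k \<equiv> \<lambda>t. h' t - a * h t"
  defines "l \<equiv> \<lambda>t. h'' t - (2 * a + 2) * h' t + a * (a + 2) * h t"
  defines "Q \<equiv> \<lambda>\<epsilon> t. exp (2 * t) * (1 / \<epsilon>\<^sup>2 * W' (1 - (f \<epsilon> (exp t))\<^sup>2))"
  shows "\<forall>\<^sub>F \<epsilon> in at_right 0. integral {B - L..B} (\<lambda>t.
    (3 * m + 9) * (k t)\<^sup>2 + 6 * k t * l t + (l t)\<^sup>2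
      - Q \<epsilon> t * ((m + 1) * (h t)\<^sup>2 + 2 * h t * k t + (k t)\<^sup>2)) < 0"
    and "\<And>\<epsilon>. 0 < \<epsilon> \<Longrightarrow> continuous_on {B - L..B} (Q \<epsilon>)"
proof -
  define A where "A = B - L"
  have AB: "A < B" using L by (simp add: A_def)
  have m1: "1 \<le> real m" using m by auto
  have ch: "continuous_on S h" "continuous_on S h'" "continuous_on S h''" for S
    using DERIV_continuous_on[OF has_field_derivative_at_within[OF h(1)], of S]
      DERIV_continuous_on[OF has_field_derivative_at_within[OF h'(1)], of S]
      continuous_on_subset[OF h'(2) subset_UNIV, of S] .
  have ckl: "continuous_on S k" "continuous_on S l" for S
    unfolding k_def l_def by (intro continuous_intros ch)+
  have r: "0 < exp t" "exp t \<le> c / 2" "exp t < 1" if "t \<in> {A..B}" for t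
  proof -
    have "exp t \<le> exp B" using that by simp
    also have "exp B = c / 2" using c by (simp add: B)
    finally show le: "exp t \<le> c / 2" .
    show "exp t < 1" using le c by linarith
  qed simp
  show contQ: "continuous_on {B - L..B} (Q \<epsilon>)" if "0 < \<epsilon>" for \<epsilon>
  proof -
    have "continuous_on {0..1} (f \<epsilon>)" using prof[OF that] by (simp add: vortex_profile_def)
    moreover have "(\<lambda>t. exp t) ` {A..B} \<subseteq> {0..1}"
      using r by (intro image_subsetI) (simp only: atLeastAtMost_iff less_imp_le)
    ultimately have cf: "continuous_on {A..B} (\<lambda>t. f \<epsilon> (exp t))"
      by (rule continuous_on_compose2[OF _ continuous_on_exp[OF continuous_on_id]])
    have "continuous_on {A..B} (\<lambda>t. W' (1 - (f \<epsilon> (exp t))\<^sup>2))"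
      by (rule continuous_on_compose2[OF W'cont]) (auto intro!: continuous_intros cf)
    then show ?thesis unfolding Q_def A_def[symmetric]
      by (intro continuous_intros) auto
  qed
  define S where "S = (\<lambda>t. (3 * m + 9) * (k t)\<^sup>2 + 6 * k t * l t + (l t)\<^sup>2)"
  define P where "P = (\<lambda>t. m * (h t)\<^sup>2 - (h' t)\<^sup>2 - (real m - 1) * \<bar>h t * h' t\<bar>)"
  have cS: "continuous_on X S" and cP: "continuous_on X P" for X
    unfolding S_def P_def by (intro continuous_intros ch ckl)+
  have iS: "S integrable_on {A..B}" and iP: "P integrable_on {A..B}"
    by (intro integrable_continuous_real cS cP)+
  \<comment> \<open>\<open>D\<close> is the balance of the two parts without error terms.\<close>
  define D where "D = integral {A..B} S - m * integral {A..B} P"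
  have "D = integral {A..B} (\<lambda>t. S t - m * P t)"
    unfolding D_def using iS iP by (simp add: integral_diff integrable_on_mult_right)
  also have "\<dots> \<le> integral {A..B} (\<lambda>t. 24 * ((h' t)\<^sup>2 + (h'' t)\<^sup>2) - (h t)\<^sup>2)"
  proof (rule integral_le)
    fix t
    show "S t - m * P t \<le> 24 * ((h' t)\<^sup>2 + (h'' t)\<^sup>2) - (h t)\<^sup>2"
      using energy_density_bound[OF m, of "h' t" "h t" "h'' t"]
      unfolding S_def P_def k_def l_def a_def by simp
  qed (intro integrable_continuous_real continuous_intros cS cP ch)+
  finally have D: "D < 0" using small by (simp add: A_def)
  define I where "I = integral {A..B} (\<lambda>t. (h t)\<^sup>2)"
  have I: "0 \<le> I" unfolding I_def
    by (intro integral_nonneg integrable_continuous_real continuous_intros ch) auto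
  \<comment> \<open>The first bound keeps \<open>1 - c^2 + \<eta>\<close> in the domain of
    \<open>W'\<close>; the second makes the error caused by \<open>\<eta>\<close> smaller than
    \<open>- D\<close>, with \<open>I + 1\<close> in place of \<open>I\<close> for
    strictness.\<close>
  define \<eta> where "\<eta> = min (c\<^sup>2) (- D * c\<^sup>2 / (m\<^sup>2 * (I + 1)))"
  have \<eta>: "0 < \<eta>" "\<eta> \<le> c\<^sup>2"
  proof -
    have "0 < - D * c\<^sup>2" using c D by (intro mult_pos_pos) auto
    moreover have "0 < m\<^sup>2 * (I + 1)" using m1 I by (intro mult_pos_pos) auto
    ultimately have "0 < - D * c\<^sup>2 / (m\<^sup>2 * (I + 1))" by (rule divide_pos_pos)
    then show "0 < \<eta>" "\<eta> \<le> c\<^sup>2" unfolding \<eta>_def using c by auto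
  qed
  have "m * (m * \<eta> / c\<^sup>2 * I) < - D"
  proof -
    have "\<eta> \<le> - D * c\<^sup>2 / (m\<^sup>2 * (I + 1))" by (simp add: \<eta>_def)
    then have "\<eta> * (m\<^sup>2 * (I + 1)) \<le> - D * c\<^sup>2"
      using I m1 by (subst (asm) pos_le_divide_eq) auto
    then have "m\<^sup>2 * \<eta> / c\<^sup>2 * (I + 1) \<le> - D"
      using c by (simp add: field_simps)
    moreover have "m\<^sup>2 * \<eta> / c\<^sup>2 * I < m\<^sup>2 * \<eta> / c\<^sup>2 * (I + 1)"
      using \<eta> c m1 by (intro mult_strict_left_mono) auto
    ultimately show ?thesis by (simp add: power2_eq_square mult.assoc)
  qed
  define P' where "P' = integral {A..B} P - m * \<eta> / c\<^sup>2 * I"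
  have neg: "integral {A..B} S - m * P' < 0"
    using \<open>m * (m * \<eta> / c\<^sup>2 * I) < - D\<close> unfolding P'_def D_def by (simp add: right_diff_distrib)
  \<comment> \<open>Where \<open>f^2 < c^2 - \<eta>\<close>, monotonicity gives
    \<open>W' (1 - f^2) \<ge> w\<close>, hence
    \<open>Q \<ge> exp (2 * A) * w / \<epsilon>^2\<close>. The quantity \<open>\<sigma>\<close> is
    the reciprocal of this bound and tends to 0 with \<open>\<epsilon>\<close>.\<close>
  define w where "w = W' (1 - c\<^sup>2 + \<eta>)"
  have w: "0 < w" unfolding w_def using \<eta> by (intro W'pos) auto
  define \<sigma> where "\<sigma> \<epsilon> = \<epsilon>\<^sup>2 * (exp (- 2 * A) / w)" for \<epsilon> :: real
  have "((\<lambda>\<epsilon>. (1 + m * \<sigma> \<epsilon>) * integral {A..B} S - m * P') \<longlongrightarrow>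
      (1 + m * \<sigma> 0) * integral {A..B} S - m * P') (at_right 0)"
    unfolding \<sigma>_def by (intro tendsto_intros)
  then have "\<forall>\<^sub>F \<epsilon> in at_right 0. (1 + m * \<sigma> \<epsilon>) * integral {A..B} S - m * P' < 0"
    using neg by (intro order_tendstoD(2)) (auto simp: \<sigma>_def)
  then show "\<forall>\<^sub>F \<epsilon> in at_right 0. integral {B - L..B} (\<lambda>t.
    (3 * m + 9) * (k t)\<^sup>2 + 6 * k t * l t + (l t)\<^sup>2
      - Q \<epsilon> t * ((m + 1) * (h t)\<^sup>2 + 2 * h t * k t + (k t)\<^sup>2)) < 0"
    using eventually_at_right_less[of 0] unfolding A_def[symmetric]
  proof eventually_elim
    case (elim \<epsilon>)
    have \<epsilon>: "0 < \<epsilon>" using elim by simp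
    have cQ: "continuous_on {A..B} (Q \<epsilon>)" using contQ[OF \<epsilon>] by (simp add: A_def)
    have sq: "(f \<epsilon> (exp t))\<^sup>2 \<le> c\<^sup>2" if "t \<in> {A..B}" for t
      by (rule profile_square_le[OF m prof[OF \<epsilon>] c(1) W'neg r[OF that]])
    have Q0: "0 \<le> Q \<epsilon> t" if "t \<in> {A..B}" for t
      using mono[of "1 - c\<^sup>2" "1 - (f \<epsilon> (exp t))\<^sup>2"] sq[OF that] W'0 by (simp add: Q_def)
    have \<sigma>: "0 < \<sigma> \<epsilon>" using \<epsilon> w by (simp add: \<sigma>_def)
    obtain f' f'' where ode: "\<And>r. 0 < r \<Longrightarrow> r < 1 \<Longrightarrow> (f \<epsilon> has_real_derivative f' r) (at r)"
        "\<And>r. 0 < r \<Longrightarrow> r < 1 \<Longrightarrow> (f' has_real_derivative f'' r) (at r)"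
        "\<And>r. 0 < r \<Longrightarrow> r < 1 \<Longrightarrow> - f'' r - m / r * f' r + m / r\<^sup>2 * f \<epsilon> r
          = 1 / \<epsilon>\<^sup>2 * (f \<epsilon> r * W' (1 - (f \<epsilon> r)\<^sup>2))"
      using prof[OF \<epsilon>] unfolding vortex_profile_def by (auto simp: Ball_def)
    have "P' \<le> (1 + m * \<sigma> \<epsilon>) * integral {A..B} (\<lambda>t. Q \<epsilon> t * (h t)\<^sup>2)"
      unfolding P'_def P_def I_def
    \<comment> \<open>With \<open>r = exp t\<close>, the operator \<open>r d/dr\<close> becomes
      \<open>d/dt\<close>, and the profile equation multiplied by \<open>r^2\<close> has constant
      coefficients apart from \<open>Q\<close>.\<close>
    proof (rule potential_lower_bound[of A B "\<lambda>t. f \<epsilon> (exp t)" "\<lambda>t. exp t * f' (exp t)"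
          "\<lambda>t. exp t * f' (exp t) + (exp t)\<^sup>2 * f'' (exp t)"])
      fix t assume t: "t \<in> {A..B}"
      note r = r[OF t]
      show "((\<lambda>t. f \<epsilon> (exp t)) has_real_derivative exp t * f' (exp t)) (at t)"
        using DERIV_chain2[OF ode(1)[OF r(1,3)] DERIV_exp] by (simp add: mult.commute)
      have "((\<lambda>t. f' (exp t)) has_real_derivative f'' (exp t) * exp t) (at t)"
        by (rule DERIV_chain2[OF ode(2)[OF r(1,3)] DERIV_exp])
      from DERIV_mult[OF DERIV_exp this]
      show "((\<lambda>t. exp t * f' (exp t)) has_real_derivative
          exp t * f' (exp t) + (exp t)\<^sup>2 * f'' (exp t)) (at t)"
        by (simp add: power2_eq_square algebra_simps)
      have "- (exp t)\<^sup>2 * f'' (exp t) - m * exp t * f' (exp t) + m * f \<epsilon> (exp t)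
          = (exp t)\<^sup>2 * (- f'' (exp t) - m / exp t * f' (exp t) + m / (exp t)\<^sup>2 * f \<epsilon> (exp t))"
        by (simp add: field_simps power2_eq_square)
      also have "\<dots> = (exp t)\<^sup>2 * (1 / \<epsilon>\<^sup>2 * (f \<epsilon> (exp t) * W' (1 - (f \<epsilon> (exp t))\<^sup>2)))"
        using ode(3)[OF r(1,3)] by simp
      also have "\<dots> = Q \<epsilon> t * f \<epsilon> (exp t)"
        by (simp add: Q_def exp_double)
      finally show "exp t * f' (exp t) + (exp t)\<^sup>2 * f'' (exp t) + (real m - 1) * (exp t * f' (exp t))
          - real m * f \<epsilon> (exp t) + Q \<epsilon> t * f \<epsilon> (exp t) = 0"
        by (simp add: algebra_simps)
      \<comment> \<open>Either \<open>f^2\<close> is within \<open>\<eta>\<close> of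
        \<open>c^2\<close>, or \<open>\<sigma> Q \<ge> 1\<close> and \<open>c^2 \<sigma> Q\<close>
        alone covers the shortfall.\<close>
      show "c\<^sup>2 - (f \<epsilon> (exp t))\<^sup>2 \<le> \<eta> + c\<^sup>2 * \<sigma> \<epsilon> * Q \<epsilon> t"
      proof (cases "c\<^sup>2 - (f \<epsilon> (exp t))\<^sup>2 \<le> \<eta>")
        case True
        moreover have "0 \<le> c\<^sup>2 * \<sigma> \<epsilon> * Q \<epsilon> t" using \<sigma> Q0[OF t] by simp
        ultimately show ?thesis by linarith
      next
        case False
        then have "w \<le> W' (1 - (f \<epsilon> (exp t))\<^sup>2)"
          unfolding w_def by (intro mono) auto
        moreover have "exp (2 * A) \<le> exp (2 * t)" using t by simp
        ultimately have "exp (2 * A) * (1 / \<epsilon>\<^sup>2 * w) \<le> Q \<epsilon> t"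
          unfolding Q_def using \<epsilon> w by (intro mult_mono) auto
        then have "\<sigma> \<epsilon> * (exp (2 * A) * (1 / \<epsilon>\<^sup>2 * w)) \<le> \<sigma> \<epsilon> * Q \<epsilon> t"
          using \<sigma> by (intro mult_left_mono) auto
        also have "\<sigma> \<epsilon> * (exp (2 * A) * (1 / \<epsilon>\<^sup>2 * w)) = 1"
          unfolding \<sigma>_def using \<epsilon> w by (simp add: exp_minus)
        finally have "c\<^sup>2 * 1 \<le> c\<^sup>2 * (\<sigma> \<epsilon> * Q \<epsilon> t)"
          by (rule mult_left_mono) simp
        moreover have "0 \<le> (f \<epsilon> (exp t))\<^sup>2" by simp
        ultimately show ?thesis using \<eta>(1) unfolding mult.assoc mult_1_right by linarith
      qed
      show "(f \<epsilon> (exp t))\<^sup>2 \<le> c\<^sup>2" "0 \<le> Q \<epsilon> t" by (rule sq[OF t] Q0[OF t])+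
    next
      show "h A = 0" using h(2) by (simp add: A_def)
    qed (rule less_imp_le[OF AB] h(1) h(3) cQ ch(2) m1 c(1))+
    define J where "J = integral {A..B} (\<lambda>t. Q \<epsilon> t * (h t)\<^sup>2)"
    have iJ: "(\<lambda>t. Q \<epsilon> t * (h t)\<^sup>2) integrable_on {A..B}"
      by (intro integrable_continuous_real continuous_intros cQ ch)
    have "m * P' \<le> m * ((1 + m * \<sigma> \<epsilon>) * J)"
      using \<open>P' \<le> _\<close> unfolding J_def by (intro mult_left_mono) auto
    then have "(1 + m * \<sigma> \<epsilon>) * integral {A..B} S < (1 + m * \<sigma> \<epsilon>) * (m * J)"
      using elim by (simp add: mult_ac)
    then have SJ: "integral {A..B} S < m * J"
      using \<sigma> m1 by (subst (asm) mult_less_cancel_left_pos) (auto intro: add_pos_nonneg)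
    have "integral {A..B} (\<lambda>t. S t - Q \<epsilon> t * ((m + 1) * (h t)\<^sup>2 + 2 * h t * k t + (k t)\<^sup>2))
        \<le> integral {A..B} (\<lambda>t. S t - m * (Q \<epsilon> t * (h t)\<^sup>2))"
    proof (rule integral_le)
      fix t assume t: "t \<in> {A..B}"
      \<comment> \<open>The bracket equals \<open>m h^2 + (h + k)^2\<close>, and the square is
        dropped because \<open>Q\<close> is nonnegative.\<close>
      have "0 \<le> Q \<epsilon> t * (h t + k t)\<^sup>2" using Q0[OF t] by simp
      then show "S t - Q \<epsilon> t * ((m + 1) * (h t)\<^sup>2 + 2 * h t * k t + (k t)\<^sup>2) \<le> S t - m * (Q \<epsilon> t * (h t)\<^sup>2)"
        by (simp add: power2_eq_square algebra_simps)
    qed (intro integrable_continuous_real continuous_intros cQ ch cS ckl)+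
    also have "\<dots> = integral {A..B} S - m * J"
      unfolding J_def using iS iJ by (simp add: integral_diff integrable_on_mult_right)
    also have "\<dots> < 0" using SJ by simp
    finally show "integral {A..B} (\<lambda>t. (3 * m + 9) * (k t)\<^sup>2 + 6 * k t * l t + (l t)\<^sup>2
        - Q \<epsilon> t * ((m + 1) * (h t)\<^sup>2 + 2 * h t * k t + (k t)\<^sup>2)) < 0"
      by (simp add: S_def)
  qed
qed

section \<open>The test function\<close>

theorem proposition4:
  fixes W W' W'' :: "real \<Rightarrow> real"
    and f :: "real \<Rightarrow> real \<Rightarrow> real"
  assumes dim: "CARD('n::finite) \<in> {2, 3}"
    and W_C1: "\<And>t. t \<le> 1 \<Longrightarrow> (W has_real_derivative W' t) (at t within {..1})"
    and W_C2: "\<And>t. t \<le> 1 \<Longrightarrow> (W' has_real_derivative W'' t) (at t within {..1})"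
    and W''_cont: "continuous_on {..1} W''"
    and W_nonneg: "\<And>t. t \<le> 1 \<Longrightarrow> 0 \<le> W t"
    and W_convex: "convex_on {..1} W"
    and W_0: "W 0 = 0"
    and W_nontrivial: "\<exists>t\<in>{0..1}. W t \<noteq> 0"
    and profile: "\<And>\<epsilon>. 0 < \<epsilon> \<Longrightarrow> vortex_profile CARD('n) W' \<epsilon> (f \<epsilon>)"
  shows "\<exists>v :: real^'n \<Rightarrow> real.
           v \<in> Cc 2 (ball 0 1 - {0}) \<and> v \<in> H20_ball \<and>
           (\<forall>\<^sub>F \<epsilon> in at_right 0. second_variation W' \<epsilon> (f \<epsilon>) (grad v) < 0)"
proof -

  \<comment> \<open>Choice of the threshold and of the stretched bump\<close>
  define m where "m = CARD('n) - 1"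
  have N: "CARD('n) = Suc m" and m: "m \<in> {1, 2}" using dim by (auto simp: m_def)
  have W'_cont: "continuous_on {..1} W'"
    by (rule DERIV_continuous_on) (rule W_C2, simp)
  obtain c where c: "0 < c" "c \<le> 1"
    and mono: "\<And>s t. s \<le> t \<Longrightarrow> t \<le> 1 \<Longrightarrow> W' s \<le> W' t"
    and W'neg: "\<And>t. t \<le> 1 - c\<^sup>2 \<Longrightarrow> W' t \<le> 0"
    and W'pos: "\<And>t. 1 - c\<^sup>2 < t \<Longrightarrow> t \<le> 1 \<Longrightarrow> 0 < W' t"
    and W'0: "W' (1 - c\<^sup>2) = 0"
    using potential_threshold[OF W_C1 W'_cont W_nonneg W_convex W_0 W_nontrivial] by blast
  \<comment> \<open>\<open>exp B = c / 2\<close> is the largest radius covered by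
    \<open>profile_square_le\<close>; \<open>c \<le> 1\<close> makes \<open>B\<close>
    negative.\<close>
  define B where "B = ln (c / 2)"
  have B: "B < 0" using c by (simp add: B_def)
  obtain L H H' H'' where L: "0 < L"
    and bump: "H \<in> smooth_bump" "H' \<in> smooth_bump" "H'' \<in> smooth_bump"
    and dH: "\<And>s. (H has_real_derivative H' s) (at s)" "\<And>s. (H' has_real_derivative H'' s) (at s)"
    and small: "integral {B - L..B} (\<lambda>t. 24 * ((H' ((t - (B - L)) / L) / L)\<^sup>2
      + (H'' ((t - (B - L)) / L) / L\<^sup>2)\<^sup>2) - (H ((t - (B - L)) / L))\<^sup>2) < 0"
  proof (rule slowly_varying_bump[of B 24])
    fix L H H' H''
    assume "0 < L" "H \<in> smooth_bump" "H' \<in> smooth_bump" "H'' \<in> smooth_bump"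
      "\<And>s. (H has_real_derivative H' s) (at s)" "\<And>s. (H' has_real_derivative H'' s) (at s)"
      "integral {B - L..B} (\<lambda>t. 24 * ((H' ((t - (B - L)) / L) / L)\<^sup>2
        + (H'' ((t - (B - L)) / L) / L\<^sup>2)\<^sup>2) - (H ((t - (B - L)) / L))\<^sup>2) < 0"
    then show thesis by (rule that[of L H H' H''])
  qed
  define A where "A = B - L"
  have AL: "A + L < 0" using B by (simp add: A_def)
  define a where "a = (real m - 1) / 2"
  define h where "h t = H ((t - A) / L)" for t
  define h' where "h' t = H' ((t - A) / L) / L" for t
  define h'' where "h'' t = H'' ((t - A) / L) / L\<^sup>2" for t
  \<comment> \<open>Differentiating \<open>exp (- a * t) * h t\<close> leaves the factor
    \<open>k\<close>; differentiating \<open>exp ((- a - 2) * t) * k t\<close> leaves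
    \<open>l = k' - (a + 2) k\<close>.\<close>
  define k where "k t = h' t - a * h t" for t
  define l where "l t = h'' t - (2 * a + 2) * h' t + a * (a + 2) * h t" for t
  define Q where "Q \<epsilon> t = exp (2 * t) * (1 / \<epsilon>\<^sup>2 * W' (1 - (f \<epsilon> (exp t))\<^sup>2))" for \<epsilon> t
  have chain: "((\<lambda>t. u ((t - A) / L)) has_real_derivative u' ((t - A) / L) * (1 / L)) (at t)"
    if "\<And>s. (u has_real_derivative u' s) (at s)" for u u' t
    by (rule DERIV_chain2[OF that]) (use L in \<open>auto intro!: derivative_eq_intros\<close>)
  have dh: "(h has_real_derivative h' t) (at t)" for t
    using chain[OF dH(1)] by (simp add: h_def[abs_def] h'_def)
  have dh': "(h' has_real_derivative h'' t) (at t)" for t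
    using DERIV_cdivide[OF chain[OF dH(2)], of L t]
    by (simp add: h'_def[abs_def] h''_def power2_eq_square)
  have ch'': "continuous_on UNIV h''"
  proof -
    obtain H3 where "\<And>s. (H'' has_real_derivative H3 s) (at s)"
      using smooth_bump_derivative[OF bump(3)] by metis
    then have "(h'' has_real_derivative H3 ((t - A) / L) * (1 / L) / L\<^sup>2) (at t)" for t
      unfolding h''_def[abs_def] by (intro DERIV_cdivide chain)
    then show ?thesis by (rule DERIV_continuous_on[OF has_field_derivative_at_within])
  qed
  have zero: "h t = 0" "h' t = 0" "h'' t = 0" "k t = 0" "l t = 0" if "t \<notin> {A<..<B}" for t
  proof -
    have "(t - A) / L \<notin> {0<..<1}" using that L by (auto simp: A_def field_simps)
    then show "h t = 0" "h' t = 0" "h'' t = 0" "k t = 0" "l t = 0"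
      by (simp_all add: k_def l_def h_def h'_def h''_def smooth_bump_support[OF bump(1)]
          smooth_bump_support[OF bump(2)] smooth_bump_support[OF bump(3)])
  qed
  have energy: "\<forall>\<^sub>F \<epsilon> in at_right 0. integral {A..B} (\<lambda>t.
      (3 * m + 9) * (k t)\<^sup>2 + 6 * k t * l t + (l t)\<^sup>2
        - Q \<epsilon> t * ((m + 1) * (h t)\<^sup>2 + 2 * h t * k t + (k t)\<^sup>2)) < 0"
    and contQ: "\<And>\<epsilon>. 0 < \<epsilon> \<Longrightarrow> continuous_on {A..B} (Q \<epsilon>)"
  proof -
    have s: "integral {B - L..B} (\<lambda>t. 24 * ((h' t)\<^sup>2 + (h'' t)\<^sup>2) - (h t)\<^sup>2) < 0"
      using small by (simp add: h_def h'_def h''_def A_def)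
    have z: "h (B - L) = 0" "h B = 0" using zero by (simp_all add: A_def)
    have prof: "vortex_profile (Suc m) W' \<epsilon> (f \<epsilon>)" if "0 < \<epsilon>" for \<epsilon>
      using profile[OF that] by (simp add: N)
    note E = radial_energy_negative[OF m c mono W'neg W'pos W'0 W'_cont prof L B_def dh z dh' ch'' s]
    show "\<forall>\<^sub>F \<epsilon> in at_right 0. integral {A..B} (\<lambda>t.
      (3 * m + 9) * (k t)\<^sup>2 + 6 * k t * l t + (l t)\<^sup>2
        - Q \<epsilon> t * ((m + 1) * (h t)\<^sup>2 + 2 * h t * k t + (k t)\<^sup>2)) < 0"
      unfolding k_def l_def Q_def a_def A_def by (rule E(1))
    show "continuous_on {A..B} (Q \<epsilon>)" if "0 < \<epsilon>" for \<epsilon>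
      unfolding Q_def[abs_def] A_def by (rule E(2); (assumption | rule that))
  qed
  have dk: "k t = - a * H ((t - A) / L) + (1 / L) * H' ((t - A) / L)" for t
    by (simp add: k_def h_def h'_def)

  \<comment> \<open>The test function and its first two derivatives\<close>
  fix i :: 'n
  \<comment> \<open>the test function is \<open>x\<^sub>i r\<^sup>-\<^sup>a h(ln r)\<close>; the power \<open>a\<close> makes the limiting energy invariant under dilations\<close>
  define \<Phi> :: "real^'n \<Rightarrow> real" where "\<Phi> = log_radial A L (- a) H"
  \<comment> \<open>\<open>K\<close> is \<open>k\<close> in the stretched variable, so that the
    radial factors \<open>p\<close> and \<open>s\<close> are again of the form
    \<open>log_radial\<close>.\<close>
  define K where "K s = - a * H s + (1 / L) * H' s" for s
  define K' where "K' s = - a * H' s + (1 / L) * H'' s" for s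
  define p :: "real^'n \<Rightarrow> real" where "p = log_radial A L (- a - 2) K"
  define s :: "real^'n \<Rightarrow> real" where
    "s = log_radial A L (- a - 2 - 2) (\<lambda>s. (- a - 2) * K s + (1 / L) * K' s)"
  have K: "K \<in> smooth_bump" unfolding K_def[abs_def]
    by (intro smooth_bump.add smooth_bump.scale bump)
  have K': "(K has_real_derivative K' s) (at s)" for s
    unfolding K_def[abs_def] K'_def by (intro DERIV_add DERIV_cmult dH)
  have d\<Phi>: "(\<Phi> has_derivative (\<lambda>w. w \<bullet> (p x *\<^sub>R x))) (at x)" for x
    using log_radial_has_derivative_bump[OF L AL bump(1) dH(1), of "- a" x]
    unfolding \<Phi>_def p_def K_def[abs_def] .
  have dp: "(p has_derivative (\<lambda>w. w \<bullet> (s x *\<^sub>R x))) (at x)" for x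
    using log_radial_has_derivative_bump[OF L AL K K', of "- a - 2" x]
    unfolding p_def s_def .
  have vals: "\<Phi> x = exp (- a * ln (norm x)) * h (ln (norm x))"
    "p x = exp ((- a - 2) * ln (norm x)) * k (ln (norm x))"
    "s x = exp ((- a - 2 - 2) * ln (norm x)) * l (ln (norm x))" for x
  proof -
    have "(- a - 2) * K ((t - A) / L) + (1 / L) * K' ((t - A) / L) = l t" for t
      unfolding l_def h_def h'_def h''_def K_def K'_def using L
      by (simp add: field_simps power2_eq_square)
    then show "\<Phi> x = exp (- a * ln (norm x)) * h (ln (norm x))"
      "p x = exp ((- a - 2) * ln (norm x)) * k (ln (norm x))"
      "s x = exp ((- a - 2 - 2) * ln (norm x)) * l (ln (norm x))"
      by (simp_all add: \<Phi>_def p_def s_def log_radial_def h_def dk K_def)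
  qed
  define v :: "real^'n \<Rightarrow> real" where "v x = (x \<bullet> axis i 1) * \<Phi> x" for x
  have v: "v \<in> annular A L"
    unfolding v_def[abs_def] \<Phi>_def by (intro annular.coord annular.radial bump)
  have grad: "grad v x = \<Phi> x *\<^sub>R axis i 1 + (x $ i * p x) *\<^sub>R x" for x
  proof (rule grad_eq)
    have "((\<lambda>x. x \<bullet> axis i 1) has_derivative (\<lambda>w. w \<bullet> axis i 1)) (at x)"
      by (auto intro!: derivative_eq_intros)
    from has_derivative_mult[OF this d\<Phi>]
    show "(v has_derivative (\<lambda>w. w \<bullet> (\<Phi> x *\<^sub>R axis i 1 + (x $ i * p x) *\<^sub>R x))) (at x)"
      unfolding v_def[abs_def]
      by (rule has_derivative_eq_rhs) (simp add: fun_eq_iff inner_add_right inner_axis)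
  qed
  have jac: "jacobian (grad v) (at x) = (\<chi> j k. p x * ((if j = i then x $ k else 0)
      + (if k = i then x $ j else 0) + (if j = k then x $ i else 0)) + s x * (x $ i * x $ j * x $ k))" for x
  proof -
    have nth: "((\<lambda>x. x $ k) has_derivative (\<lambda>w. w $ k)) (at x)" for k
      by (rule bounded_linear.has_derivative[OF bounded_linear_vec_nth has_derivative_ident])
    define d where "d j = (if j = i then 1 else 0 :: real)" for j
    have comp: "grad v x $ j = \<Phi> x * d j + (x $ i * p x) * x $ j" for x j
      by (simp add: grad d_def axis_def)
    have "((\<lambda>x. grad v x $ j) has_derivative (\<lambda>w. w \<bullet> ((d j * p x) *\<^sub>R x + (x $ j * p x) *\<^sub>R axis i 1
        + (x $ i * p x) *\<^sub>R axis j 1 + (x $ i * x $ j * s x) *\<^sub>R x))) (at x)" for j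
      unfolding comp
      by (rule has_derivative_eq_rhs[OF has_derivative_add[OF has_derivative_mult_left[OF d\<Phi>]
            has_derivative_mult[OF has_derivative_mult[OF nth dp] nth]]])
        (simp add: fun_eq_iff inner_add_right inner_axis algebra_simps)
    from jacobian_eq[OF this] show ?thesis
      by (simp add: vec_eq_iff d_def axis_def algebra_simps)
  qed
  have norm_grad: "(norm (grad v x))\<^sup>2 = (\<Phi> x)\<^sup>2 + (x $ i)\<^sup>2 * (2 * \<Phi> x * p x + (p x)\<^sup>2 * (norm x)\<^sup>2)" for x
    unfolding grad power2_norm_eq_inner
    by (simp add: inner_add_left inner_add_right inner_axis_axis inner_axis inner_axis'
        power2_eq_square algebra_simps)
  have norm_hess: "(norm (jacobian (grad v) (at x)))\<^sup>2 = 2 * (p x)\<^sup>2 * (norm x)\<^sup>2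
      + (x $ i)\<^sup>2 * ((real CARD('n) + 6) * (p x)\<^sup>2 + 6 * p x * s x * (norm x)\<^sup>2
        + (s x)\<^sup>2 * ((norm x)\<^sup>2)\<^sup>2)" for x
    unfolding jac by (rule norm_hessian_sq)

  \<comment> \<open>Reduction of the second variation to an integral over
    \<open>t = ln r\<close>\<close>
  have second: "second_variation W' \<epsilon> (f \<epsilon>) (grad v) = unit_ball_vol CARD('n) / 2 * integral {A..B} (\<lambda>t.
      (3 * m + 9) * (k t)\<^sup>2 + 6 * k t * l t + (l t)\<^sup>2
        - Q \<epsilon> t * ((m + 1) * (h t)\<^sup>2 + 2 * h t * k t + (k t)\<^sup>2))" if \<epsilon>: "0 < \<epsilon>" for \<epsilon>
  proof -
    define F where "F t = exp (- a * t) * h t" for t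
    define P where "P t = exp ((- a - 2) * t) * k t" for t
    define S where "S t = exp ((- a - 2 - 2) * t) * l t" for t
    define q where "q t = exp (- 2 * t) * Q \<epsilon> t" for t
    \<comment> \<open>\<open>\<alpha>\<close> and \<open>\<beta>\<close> collect the parts of the
      energy density without and with the factor \<open>(x $ i)^2\<close>.\<close>
    define \<alpha> where "\<alpha> t = 2 * exp (2 * t) * (P t)\<^sup>2 - q t * (F t)\<^sup>2" for t
    define \<beta> where "\<beta> t = (real CARD('n) + 6) * (P t)\<^sup>2 + 6 * P t * S t * exp (2 * t)
      + (S t)\<^sup>2 * (exp (2 * t))\<^sup>2 - q t * (2 * F t * P t + (P t)\<^sup>2 * exp (2 * t))" for t
    have ch: "continuous_on {A..B} h" "continuous_on {A..B} h'" "continuous_on {A..B} h''"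
      using DERIV_continuous_on[OF has_field_derivative_at_within[OF dh], of "{A..B}"]
        DERIV_continuous_on[OF has_field_derivative_at_within[OF dh'], of "{A..B}"]
        continuous_on_subset[OF ch'' subset_UNIV, of "{A..B}"] .
    have cFPS: "continuous_on {A..B} F" "continuous_on {A..B} P" "continuous_on {A..B} S"
      "continuous_on {A..B} q"
      unfolding F_def P_def S_def q_def k_def l_def
      by (intro continuous_intros ch contQ[OF \<epsilon>])+
    have c\<alpha>: "continuous_on {A..B} \<alpha>" and c\<beta>: "continuous_on {A..B} \<beta>"
      unfolding \<alpha>_def \<beta>_def by (intro continuous_intros cFPS)+
    let ?J = "\<lambda>x. indicator {A..B} (ln (norm x)) * (\<alpha> (ln (norm x)) + (x $ i)\<^sup>2 * \<beta> (ln (norm x)))"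
    \<comment> \<open>The identity holds at every point: outside the annulus both sides vanish,
      including the origin, where \<open>ln 0 = 0\<close> lies above \<open>B\<close>.\<close>
    have J: "indicator (ball 0 1) x *\<^sub>R ((norm (jacobian (grad v) (at x)))\<^sup>2
        - 1 / \<epsilon>\<^sup>2 * W' (1 - (f \<epsilon> (norm x))\<^sup>2) * (norm (grad v x))\<^sup>2) = ?J x" for x :: "real^'n"
    proof (cases "ln (norm x) \<in> {A..B}")
      case True
      then have "x \<noteq> 0" using B by auto
      then have e: "norm x = exp (ln (norm x))" by simp
      have "ln (norm x) < 0" using True B by simp
      then have "norm x < 1" using \<open>x \<noteq> 0\<close> by (simp add: ln_less_zero_iff)
      have e2: "(norm x)\<^sup>2 = exp (2 * ln (norm x))"
        using \<open>x \<noteq> 0\<close> by (simp add: exp_double)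
      have q: "1 / \<epsilon>\<^sup>2 * W' (1 - (f \<epsilon> (norm x))\<^sup>2) = q (ln (norm x))"
        unfolding q_def Q_def using \<open>x \<noteq> 0\<close> by (simp add: exp_minus)
      show ?thesis
        unfolding norm_hess norm_grad vals q e2 F_def[symmetric] P_def[symmetric] S_def[symmetric]
        using True \<open>norm x < 1\<close> by (simp add: \<alpha>_def \<beta>_def algebra_simps)
    next
      case False
      then have "ln (norm x) \<notin> {A<..<B}" by auto
      then show ?thesis
        using False unfolding norm_hess norm_grad vals by (simp add: zero)
    qed
    have "(LINT x:ball 0 1|lebesgue. (norm (jacobian (grad v) (at x)))\<^sup>2
        - 1 / \<epsilon>\<^sup>2 * W' (1 - (f \<epsilon> (norm x))\<^sup>2) * (norm (grad v x))\<^sup>2) = integral\<^sup>L lebesgue ?J"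
      unfolding set_lebesgue_integral_def J ..
    also have "\<dots> = integral\<^sup>L lborel ?J"
      by (rule integral_completion) (use integral_annulus_log_radial(1)[OF c\<alpha> c\<beta>] in simp)
    also have "\<dots> = unit_ball_vol CARD('n) * integral {A..B}
        (\<lambda>t. CARD('n) * exp (CARD('n) * t) * \<alpha> t + exp ((real CARD('n) + 2) * t) * \<beta> t)"
      by (rule integral_annulus_log_radial(2)[OF c\<alpha> c\<beta>])
    also have "(\<lambda>t::real. CARD('n) * exp (CARD('n) * t) * \<alpha> t + exp ((real CARD('n) + 2) * t) * \<beta> t)
      = (\<lambda>t::real. (3 * m + 9) * (k t)\<^sup>2 + 6 * k t * l t + (l t)\<^sup>2
        - Q \<epsilon> t * ((m + 1) * (h t)\<^sup>2 + 2 * h t * k t + (k t)\<^sup>2))"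
      (is "?lhs = ?rhs")
    proof
      fix t :: real
      \<comment> \<open>The dimension equals \<open>2 * a + 2\<close>, so the volume factor cancels
        all powers of \<open>r\<close>. The terms with \<open>k^2\<close> add up to
        \<open>2 N + (N + 6) = 3 * m + 9\<close>, where \<open>N = m + 1\<close>.\<close>
      define E u where "E = exp (a * t)" and "u = exp t"
      have pos: "E \<noteq> 0" "u \<noteq> 0" by (simp_all add: E_def u_def)
      have "real CARD('n) = 2 * a + 2" by (simp add: N a_def field_simps)
      then have "real CARD('n) * t = a * t + a * t + t + t"
        "(real CARD('n) + 2) * t = a * t + a * t + t + t + t + t"
        by (simp_all add: algebra_simps)
      then have ex: "exp (real CARD('n) * t) = E\<^sup>2 * u\<^sup>2" "exp ((real CARD('n) + 2) * t) = E\<^sup>2 * u ^ 4"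
        by (simp_all only: exp_add E_def u_def) (simp_all add: power2_eq_square power4_eq_xxxx)
      have e2: "exp (2 * t) = u\<^sup>2" by (simp add: u_def exp_double)
      have "- a * t = - (a * t)" "(- a - 2) * t = - (a * t + t + t)"
        "(- a - 2 - 2) * t = - (a * t + t + t + t + t)" "- 2 * t = - (t + t)"
        by (simp_all add: algebra_simps)
      then have FPS: "F t = h t / E" "P t = k t / (E * u\<^sup>2)" "S t = l t / (E * u ^ 4)" "q t = Q \<epsilon> t / u\<^sup>2"
        unfolding F_def P_def S_def q_def
        by (simp_all only: exp_add exp_minus E_def u_def)
          (simp_all add: power2_eq_square power4_eq_xxxx field_simps)
      have n: "real CARD('n) = real m + 1" by (simp add: N)
      show "?lhs t = ?rhs t"
        unfolding ex \<alpha>_def \<beta>_def FPS e2 unfolding n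
        using pos by (simp add: field_simps power2_eq_square power4_eq_xxxx)
    qed
    finally show ?thesis by (simp add: second_variation_def)
  qed
  have "\<forall>\<^sub>F \<epsilon> in at_right 0. second_variation W' \<epsilon> (f \<epsilon>) (grad v) < 0"
    using energy eventually_at_right_less[of 0]
  proof eventually_elim
    case (elim \<epsilon>)
    then show ?case
      unfolding second[OF elim(2)] by (intro mult_pos_neg) auto
  qed
  with annular_Cc[OF L AL v, of 2] annular_H20[OF L AL v] show ?thesis by blast
qed

end
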